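(* Assume QEPmin is in the easy case, let $v_*$ be the unique minimizer of CRQopt and $(\lambda_*,u_* )$ the minimizer of LGopt, let $\theta_{\min}$ and $\theta_{\max}$ be the smallest and largest eigenvalues of $H$, and $\kappa=\frac{\theta_{\max}-\lambda_*}{\theta_{\min}-\lambda_*}$. Then for every $k\le k_{\max}$ and any nonzero $v\in n_0+\mathcal K_k(PAP,b_0)$: $0\le h(v^{(k)})-h(v_* )\le 4\|H-\lambda_*I\|_2\,\|v-v_*\|_2^2$, $\|v^{(k)}-v_*\|\le 2\sqrt\kappa\,\|v-v_*\|_2$, $|\mu^{(k)}-\lambda_*|\le\frac{1}{\gamma^2}\left[4\|H-\lambda_*I\|_2\,\|v-v_*\|_2^2+2\sqrt\kappa\,\|b_0\|_2\,\|v-v_*\|_2\right]$.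
   Context: Let $A\in\mathbb{R}^{n\times n}$ be symmetric, $C\in\mathbb{R}^{n\times m}$ ($m<n$) full column rank, $b\in\mathbb{R}^m$, $n_0=C(C^{\top}C)^{-1}b$ with $\|n_0\|<1$, $\gamma=\sqrt{1-\|n_0\|^2}$, $P=I-C(C^{\top}C)^{-1}C^{\top}$ (orthogonal projector onto $\mathcal N(C^{\top})$), $b_0=PAn_0\neq0$, $h(v)=v^{\top}Av$. CRQopt: minimize $h(v)$ s.t. $v^{\top}v=1$, $C^{\top}v=b$. LGopt: minimize $\lambda$ over $(\lambda,u)$ with $(PAP-\lambda I)u=-b_0$, $\|u\|=\gamma$, $u\in\mathcal N(C^{\top})$. QEPmin: minimize $\lambda$ over $(\lambda,z)$, $\lambda\in\mathbb{R}$, $0\ne z\in\mathcal N(C^{\top})$, $(PAP-\lambda I)^2z=\gamma^{-2}b_0b_0^{\top}z$; it is in the hard case if it has a minimizer with $b_0^{\top}z=0$, otherwise in the easy case. $S_1\in\mathbb{R}^{n\times(n-m)}$ has orthonormal columns spanning $\mathcal N(C^{\top})$ and $H=S_1^{\top}AS_1$. $\mathcal K_k(PAP,b_0)=\operatorname{span}\{b_0,\dots,(PAP)^{k-1}b_0\}$. Lanczos process with $M=PAP$: $q_0=0$, $\beta_1=\|b_0\|$, $q_1=b_0/\|b_0\|$, for $j\ge1$: $\alpha_j=q_j^{\top}Mq_j$, $\widehat q_{j+1}=Mq_j-\alpha_jq_j-\beta_jq_{j-1}$, $\beta_{j+1}=\|\widehat q_{j+1}\|$, $q_{j+1}=\widehat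 q_{j+1}/\beta_{j+1}$ when $\beta_{j+1}>0$; $k_{\max}$ is the smallest $k$ with $\beta_{k+1}=0$; $Q_k=[q_1,\dots,q_k]$, $T_k=Q_k^{\top}PAPQ_k$. rLGopt: minimize $\lambda$ over $(\lambda,x)\in\mathbb{R}\times\mathbb{R}^k$ with $(T_k-\lambda I)x=-\|b_0\|e_1$, $\|x\|=\gamma$; $(\mu^{(k)},x^{(k)})$ is its minimizer and $v^{(k)}=n_0+Q_kx^{(k)}$. *)

theory Defs
  imports "HOL-Analysis.Analysis"
begin

text \<open>Quadratic form h(v) = v^T A v.\<close>
definition hq :: "real^'n^'n \<Rightarrow> real^'n \<Rightarrow> real" where
  "hq A v = v \<bullet> (A *v v)"

definition n0vec :: "real^'m^'n \<Rightarrow> real^'m \<Rightarrow> real^'n" where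
  "n0vec C b = (C ** matrix_inv (transpose C ** C)) *v b"

definition projP :: "real^'m^'n \<Rightarrow> real^'n^'n" where
  "projP C = mat 1 - C ** matrix_inv (transpose C ** C) ** transpose C"

definition gam :: "real^'m^'n \<Rightarrow> real^'m \<Rightarrow> real" where
  "gam C b = sqrt (1 - (norm (n0vec C b))\<^sup>2)"

definition b0vec :: "real^'n^'n \<Rightarrow> real^'m^'n \<Rightarrow> real^'m \<Rightarrow> real^'n" where
  "b0vec A C b = projP C *v (A *v n0vec C b)"

text \<open>CRQopt: minimize h(v) s.t. v^T v = 1, C^T v = b.\<close>
definition crq_feasible :: "real^'m^'n \<Rightarrow> real^'m \<Rightarrow> real^'n \<Rightarrow> bool" where
  "crq_feasible C b v \<longleftrightarrow> v \<bullet> v = 1 \<and> transpose C *v v = b"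

definition crq_minimizer :: "real^'n^'n \<Rightarrow> real^'m^'n \<Rightarrow> real^'m \<Rightarrow> real^'n \<Rightarrow> bool" where
  "crq_minimizer A C b v \<longleftrightarrow> crq_feasible C b v \<and>
     (\<forall>w. crq_feasible C b w \<longrightarrow> hq A v \<le> hq A w)"

text \<open>LGopt: minimize lambda s.t. (PAP - lambda I) u = -b0, norm u = gamma, u in N(C^T).\<close>
definition lg_feasible :: "real^'n^'n \<Rightarrow> real^'m^'n \<Rightarrow> real^'m \<Rightarrow> real \<Rightarrow> real^'n \<Rightarrow> bool" where
  "lg_feasible A C b lam u \<longleftrightarrow>
     (projP C ** A ** projP C - lam *\<^sub>R mat 1) *v u = - b0vec A C b \<and>
     norm u = gam C b \<and> transpose C *v u = 0"

definition lg_minimizer :: "real^'n^'n \<Rightarrow> real^'m^'n \<Rightarrow> real^'m \<Rightarrow> real \<Rightarrow> real^'n \<Rightarrow> bool" where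
  "lg_minimizer A C b lam u \<longleftrightarrow> lg_feasible A C b lam u \<and>
     (\<forall>lam' u'. lg_feasible A C b lam' u' \<longrightarrow> lam \<le> lam')"

text \<open>QEPmin.\<close>
definition qep_feasible :: "real^'n^'n \<Rightarrow> real^'m^'n \<Rightarrow> real^'m \<Rightarrow> real \<Rightarrow> real^'n \<Rightarrow> bool" where
  "qep_feasible A C b lam z \<longleftrightarrow> z \<noteq> 0 \<and> transpose C *v z = 0 \<and>
     (let N = projP C ** A ** projP C - lam *\<^sub>R mat 1
      in (N ** N) *v z = (1 / (gam C b)\<^sup>2) *\<^sub>R ((b0vec A C b \<bullet> z) *\<^sub>R b0vec A C b))"

definition qep_minimizer :: "real^'n^'n \<Rightarrow> real^'m^'n \<Rightarrow> real^'m \<Rightarrow> real \<Rightarrow> real^'n \<Rightarrow> bool" where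
  "qep_minimizer A C b lam z \<longleftrightarrow> qep_feasible A C b lam z \<and>
     (\<forall>lam' z'. qep_feasible A C b lam' z' \<longrightarrow> lam \<le> lam')"

definition qep_hard_case :: "real^'n^'n \<Rightarrow> real^'m^'n \<Rightarrow> real^'m \<Rightarrow> bool" where
  "qep_hard_case A C b \<longleftrightarrow> (\<exists>lam z. qep_minimizer A C b lam z \<and> b0vec A C b \<bullet> z = 0)"

definition qep_easy_case :: "real^'n^'n \<Rightarrow> real^'m^'n \<Rightarrow> real^'m \<Rightarrow> bool" where
  "qep_easy_case A C b \<longleftrightarrow> \<not> qep_hard_case A C b"

text \<open>Eigenvalues of a square matrix.\<close>
definition eigvals :: "real^'k^'k \<Rightarrow> real set" where
  "eigvals H = {t. \<exists>x. x \<noteq> 0 \<and> H *v x = t *\<^sub>R x}"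

text \<open>Lanczos process.  lanczos M b j = (q_j, q_(j+1), beta_(j+1)).\<close>
primrec lanczos :: "real^'n^'n \<Rightarrow> real^'n \<Rightarrow> nat \<Rightarrow> (real^'n) \<times> (real^'n) \<times> real" where
  "lanczos M b 0 = (0, b /\<^sub>R norm b, norm b)"
| "lanczos M b (Suc j) =
     (case lanczos M b j of (qp, q, be) \<Rightarrow>
       (let w = M *v q - (q \<bullet> (M *v q)) *\<^sub>R q - be *\<^sub>R qp
        in (q, w /\<^sub>R norm w, norm w)))"

text \<open>q_j for j >= 1.\<close>
definition lq :: "real^'n^'n \<Rightarrow> real^'n \<Rightarrow> nat \<Rightarrow> real^'n" where
  "lq M b j = fst (snd (lanczos M b (j - 1)))"

text \<open>beta_j for j >= 1.\<close>
definition lbeta :: "real^'n^'n \<Rightarrow> real^'n \<Rightarrow> nat \<Rightarrow> real" where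
  "lbeta M b j = snd (snd (lanczos M b (j - 1)))"

text \<open>k_max: smallest k (>= 1) with beta_(k+1) = 0.\<close>
definition kmax :: "real^'n^'n \<Rightarrow> real^'n \<Rightarrow> nat" where
  "kmax M b = (LEAST k. 1 \<le> k \<and> lbeta M b (k + 1) = 0)"

text \<open>Entries of T_k = Q_k^T M Q_k (indices 1..k).\<close>
definition Tk :: "real^'n^'n \<Rightarrow> real^'n \<Rightarrow> nat \<Rightarrow> nat \<Rightarrow> real" where
  "Tk M b i j = lq M b i \<bullet> (M *v lq M b j)"

text \<open>rLGopt, with x in R^k represented as nat => real on indices 1..k.\<close>
definition rlg_feasible :: "real^'n^'n \<Rightarrow> real^'n \<Rightarrow> real \<Rightarrow> nat \<Rightarrow> real \<Rightarrow> (nat \<Rightarrow> real) \<Rightarrow> bool" where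
  "rlg_feasible M b g k lam x \<longleftrightarrow>
     (\<forall>i\<in>{1..k}. (\<Sum>j=1..k. Tk M b i j * x j) - lam * x i = (if i = 1 then - norm b else 0)) \<and>
     sqrt (\<Sum>i=1..k. (x i)\<^sup>2) = g"

definition rlg_minimizer :: "real^'n^'n \<Rightarrow> real^'n \<Rightarrow> real \<Rightarrow> nat \<Rightarrow> real \<Rightarrow> (nat \<Rightarrow> real) \<Rightarrow> bool" where
  "rlg_minimizer M b g k lam x \<longleftrightarrow> rlg_feasible M b g k lam x \<and>
     (\<forall>lam' x'. rlg_feasible M b g k lam' x' \<longrightarrow> lam \<le> lam')"

text \<open>Krylov subspace K_k(M, b).\<close>
definition krylov :: "real^'n^'n \<Rightarrow> real^'n \<Rightarrow> nat \<Rightarrow> (real^'n) set" where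
  "krylov M b k = span ((\<lambda>i. (((*v) M) ^^ i) b) ` {..<k})"

end

theory Submission
  imports Defs "HOL-Real_Asymp.Real_Asymp"
begin

text \<open>On the affine space \<open>n\<^sub>0 + \<N>(C\<^sup>T)\<close>, CRQopt is the trust-region subproblem of minimising
  \<open>f(w) = w\<^sup>T PAP w + 2 b\<^sub>0\<^sup>T w\<close> over the sphere \<open>\<parallel>w\<parallel> = \<gamma>\<close>. LGopt is its KKT system, and the
  least KKT multiplier \<open>\<lambda>\<^sub>*\<close> makes \<open>PAP - \<lambda>\<^sub>* I\<close> positive semidefinite on \<open>\<N>(C\<^sup>T)\<close>, so that
  \<open>f(w) - f(u\<^sub>*) = (w - u\<^sub>*)\<^sup>T (PAP - \<lambda>\<^sub>* I) (w - u\<^sub>*)\<close> for every feasible \<open>w\<close>. rLGopt is the same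
  problem on the Krylov subspace, written in the orthonormal Lanczos basis; its solution \<open>u\<^sub>k\<close>
  therefore does at least as well as the rescaling \<open>w\<close> of \<open>v - n\<^sub>0\<close> to the sphere, which lies
  within \<open>2 \<parallel>v - v\<^sub>*\<parallel>\<close> of \<open>u\<^sub>*\<close>. Bounding the quadratic form by \<open>\<theta>\<^sub>m\<^sub>i\<^sub>n - \<lambda>\<^sub>*\<close> (positive in the easy
  case), \<open>\<theta>\<^sub>m\<^sub>a\<^sub>x - \<lambda>\<^sub>*\<close> and \<open>\<parallel>H - \<lambda>\<^sub>* I\<parallel>\<close> gives the estimates for \<open>h\<close> and \<open>v\<^sup>(\<^sup>k\<^sup>)\<close>; the identity
  \<open>\<lambda> \<gamma>\<^sup>2 = f(u) - b\<^sub>0\<^sup>T u\<close>, valid for both KKT pairs, gives the one for \<open>\<mu>\<^sup>(\<^sup>k\<^sup>)\<close>.\<close>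

section \<open>Sign conditions on real polynomials\<close>

lemma quadratic_nonneg_imp_linear_coeff_zero:
  fixes b c :: real
  assumes "\<And>t. 0 \<le> b * t + c * t\<^sup>2"
  shows "b = 0"
proof -
  have "((\<lambda>t. (b * t + c * t\<^sup>2) / t) \<longlongrightarrow> b) (at_right 0)"
    and "((\<lambda>t. (b * t + c * t\<^sup>2) / t) \<longlongrightarrow> b) (at_left 0)"
    by real_asymp+
  moreover have "eventually (\<lambda>t. 0 \<le> (b * t + c * t\<^sup>2) / t) (at_right 0)"
    using eventually_at_right_less[of 0] by (rule eventually_mono) (simp add: assms)
  moreover have "eventually (\<lambda>t. (b * t + c * t\<^sup>2) / t \<le> 0) (at_left 0)"
    using eventually_at_left_real[of "-1" 0] by (rule eventually_mono) (auto intro: divide_nonneg_neg assms)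
  ultimately have "0 \<le> b" "b \<le> 0"
    by (auto intro: tendsto_lowerbound tendsto_upperbound)
  then show ?thesis by simp
qed

lemma quadratic_nonneg_off_zero_imp_const_nonneg:
  fixes a b c :: real
  assumes "\<And>t. t \<noteq> 0 \<Longrightarrow> 0 \<le> a + b * t + c * t\<^sup>2"
  shows "0 \<le> a"
proof -
  have "((\<lambda>t. a + b * t + c * t\<^sup>2) \<longlongrightarrow> a) (at 0)"
    by real_asymp
  moreover have "eventually (\<lambda>t. 0 \<le> a + b * t + c * t\<^sup>2) (at 0)"
    using assms by (auto simp: eventually_at_filter)
  ultimately show ?thesis
    by (rule tendsto_lowerbound) simp
qed

lemma cubic_nonneg_imp_leading_coeff_zero:
  fixes a b c d :: real
  assumes "\<And>t. 0 \<le> a + b * t + c * t\<^sup>2 + d * t ^ 3"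
  shows "d = 0"
proof -
  have "((\<lambda>t. (a + b * t + c * t\<^sup>2 + d * t ^ 3) / t ^ 3) \<longlongrightarrow> d) at_top"
    and "((\<lambda>t. (a + b * t + c * t\<^sup>2 + d * t ^ 3) / t ^ 3) \<longlongrightarrow> d) at_bot"
    by real_asymp+
  moreover have "eventually (\<lambda>t. 0 \<le> (a + b * t + c * t\<^sup>2 + d * t ^ 3) / t ^ 3) at_top"
    using eventually_gt_at_top[of 0] by (rule eventually_mono) (simp add: assms)
  moreover have "eventually (\<lambda>t. (a + b * t + c * t\<^sup>2 + d * t ^ 3) / t ^ 3 \<le> 0) at_bot"
    using eventually_gt_at_bot[of 0] by (rule eventually_mono)
      (simp add: assms divide_nonneg_neg power_less_zero_eq)
  ultimately have "0 \<le> d" "d \<le> 0"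
    by (auto intro: tendsto_lowerbound tendsto_upperbound)
  then show ?thesis by simp
qed

section \<open>The trust-region subproblem on a subspace\<close>

definition trs_obj :: "real^'n^'n \<Rightarrow> real^'n \<Rightarrow> real^'n \<Rightarrow> real" where
  "trs_obj M g w = w \<bullet> (M *v w) + 2 * (g \<bullet> w)"

definition shifted_form :: "real^'n^'n \<Rightarrow> real \<Rightarrow> real^'n \<Rightarrow> real" where
  "shifted_form M l w = w \<bullet> (M *v w) - l * (w \<bullet> w)"

definition psd_on :: "real^'n^'n \<Rightarrow> real \<Rightarrow> (real^'n) set \<Rightarrow> bool" where
  "psd_on M l V \<longleftrightarrow> (\<forall>w\<in>V. 0 \<le> shifted_form M l w)"

text \<open>The trust-region subproblem on a subspace \<open>V\<close>; \<open>l\<close> is the multiplier of the sphere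
  constraint. LGopt is its KKT system on \<open>\<N>(C\<^sup>T)\<close>, rLGopt the one on the Krylov subspace.\<close>

definition trs_minimizer :: "real^'n^'n \<Rightarrow> real^'n \<Rightarrow> (real^'n) set \<Rightarrow> real \<Rightarrow> real^'n \<Rightarrow> bool" where
  "trs_minimizer M g V r u \<longleftrightarrow> u \<in> V \<and> norm u = r \<and>
     (\<forall>w\<in>V. norm w = r \<longrightarrow> trs_obj M g u \<le> trs_obj M g w)"

definition trs_kkt :: "real^'n^'n \<Rightarrow> real^'n \<Rightarrow> (real^'n) set \<Rightarrow> real \<Rightarrow> real \<Rightarrow> real^'n \<Rightarrow> bool" where
  "trs_kkt M g V r l u \<longleftrightarrow> u \<in> V \<and> norm u = r \<and> (\<forall>w\<in>V. w \<bullet> (M *v u - l *\<^sub>R u + g) = 0)"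

lemma matrix_vector_mult_minus: "(M :: real^'n^'m) *v (- x) = - (M *v x)"
  using matrix_vector_mult_diff_distrib[of M 0 x] by simp

lemma symmetric_matrix_inner:
  fixes M :: "real^'n^'n"
  assumes "transpose M = M"
  shows "x \<bullet> (M *v y) = y \<bullet> (M *v x)"
  by (metis assms dot_lmul_matrix inner_commute transpose_matrix_vector)

lemma symmetric_quadratic_add:
  fixes M :: "real^'n^'n"
  assumes "transpose M = M"
  shows "(x + y) \<bullet> (M *v (x + y)) = x \<bullet> (M *v x) + 2 * (y \<bullet> (M *v x)) + y \<bullet> (M *v y)"
proof -
  have "x \<bullet> (M *v y) = y \<bullet> (M *v x)"
    by (rule symmetric_matrix_inner[OF assms])
  then show ?thesis
    by (simp add: matrix_vector_right_distrib inner_add_left inner_add_right)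
qed

lemma norm_reflection:
  fixes u w :: "'a::real_inner"
  assumes "w \<noteq> 0"
  shows "norm (u - (2 * (u \<bullet> w) / (w \<bullet> w)) *\<^sub>R w) = norm u"
proof -
  have "(norm (u - (2 * (u \<bullet> w) / (w \<bullet> w)) *\<^sub>R w))\<^sup>2 = (norm u)\<^sup>2"
    using assms unfolding power2_norm_eq_inner
    by (simp add: inner_diff_left inner_diff_right field_simps power2_eq_square inner_commute)
  then show ?thesis by (simp add: power2_eq_iff_nonneg)
qed

lemma trs_obj_diff_scaled:
  fixes M :: "real^'n^'n"
  assumes "transpose M = M"
  shows "trs_obj M g (u - t *\<^sub>R w) - trs_obj M g u = t\<^sup>2 * (w \<bullet> (M *v w)) - 2 * t * (w \<bullet> (M *v u + g))"
proof -
  have "(u - t *\<^sub>R w) \<bullet> (M *v (u - t *\<^sub>R w))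
      = u \<bullet> (M *v u) - 2 * t * (w \<bullet> (M *v u)) + t\<^sup>2 * (w \<bullet> (M *v w))"
    using symmetric_quadratic_add[OF assms, of u "(- t) *\<^sub>R w"]
    by (simp add: matrix_vector_mult_minus matrix_vector_mult_scaleR power2_eq_square)
  moreover have "g \<bullet> (u - t *\<^sub>R w) = g \<bullet> u - t * (w \<bullet> g)"
    by (simp add: inner_diff_right inner_commute)
  ultimately show ?thesis
    by (simp add: trs_obj_def inner_add_right right_diff_distrib distrib_left)
qed

lemma shifted_form_add_scaled:
  fixes M :: "real^'n^'n"
  assumes "transpose M = M"
  shows "shifted_form M l (z + t *\<^sub>R w)
    = shifted_form M l z + 2 * t * (w \<bullet> (M *v z - l *\<^sub>R z)) + t\<^sup>2 * shifted_form M l w"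
proof -
  have "(z + t *\<^sub>R w) \<bullet> (M *v (z + t *\<^sub>R w))
      = z \<bullet> (M *v z) + 2 * t * (w \<bullet> (M *v z)) + t\<^sup>2 * (w \<bullet> (M *v w))"
    using symmetric_quadratic_add[OF assms, of z "t *\<^sub>R w"]
    by (simp add: matrix_vector_mult_scaleR power2_eq_square)
  moreover have "(z + t *\<^sub>R w) \<bullet> (z + t *\<^sub>R w) = z \<bullet> z + 2 * t * (w \<bullet> z) + t\<^sup>2 * (w \<bullet> w)"
    by (simp add: inner_add_left inner_add_right inner_commute[of z w] power2_eq_square distrib_left)
  ultimately show ?thesis
    by (simp add: shifted_form_def inner_diff_right right_diff_distrib distrib_left)
qed

lemma trs_kkt_obj_diff:
  fixes M :: "real^'n^'n"
  assumes sym: "transpose M = M" and kkt: "trs_kkt M g V r l u" and w: "w \<in> V" "norm w = r"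
  shows "trs_obj M g w - trs_obj M g u = shifted_form M l (w - u)"
proof -
  have "u \<in> V" "norm u = r" and stat: "\<forall>w\<in>V. w \<bullet> (M *v u - l *\<^sub>R u + g) = 0"
    using kkt unfolding trs_kkt_def by auto
  with w have "(w - u) \<bullet> (M *v u - l *\<^sub>R u + g) = 0"
    by (simp add: inner_diff_left)
  then have "(w - u) \<bullet> (M *v u) + (w - u) \<bullet> g = l * ((w - u) \<bullet> u)"
    by (simp add: inner_add_right inner_diff_right)
  moreover have "w \<bullet> (M *v w) = u \<bullet> (M *v u) + 2 * ((w - u) \<bullet> (M *v u)) + (w - u) \<bullet> (M *v (w - u))"
    using symmetric_quadratic_add[OF sym, of u "w - u"] by simp
  moreover have "w \<bullet> w = u \<bullet> u"
    using \<open>norm u = r\<close> w(2) by (simp add: dot_square_norm)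
  then have "(w - u) \<bullet> (w - u) = - 2 * ((w - u) \<bullet> u)"
    by (simp add: inner_diff_left inner_diff_right inner_commute)
  moreover have "g \<bullet> w - g \<bullet> u = (w - u) \<bullet> g"
    by (metis inner_commute inner_diff_right)
  ultimately show ?thesis
    unfolding trs_obj_def shifted_form_def by (simp add: right_diff_distrib)
qed

lemma trs_kkt_multiplier_eq:
  assumes "trs_kkt M g V r l u"
  shows "l * r\<^sup>2 = trs_obj M g u - g \<bullet> u"
proof -
  have "u \<bullet> (M *v u - l *\<^sub>R u + g) = 0" "u \<bullet> u = r\<^sup>2"
    using assms by (auto simp: trs_kkt_def power2_norm_eq_inner)
  then show ?thesis
    by (simp add: trs_obj_def inner_add_right inner_diff_right inner_commute)
qed

lemma trs_kkt_psd_imp_minimizer: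
  fixes M :: "real^'n^'n"
  assumes "transpose M = M" "subspace V" "trs_kkt M g V r l u" "psd_on M l V"
  shows "trs_minimizer M g V r u"
  unfolding trs_minimizer_def
proof (intro conjI ballI impI)
  show "u \<in> V" "norm u = r"
    using assms(3) by (auto simp: trs_kkt_def)
  fix w assume "w \<in> V" "norm w = r"
  with \<open>u \<in> V\<close> have "0 \<le> shifted_form M l (w - u)"
    using assms(2,4) by (simp add: psd_on_def subspace_diff)
  then show "trs_obj M g u \<le> trs_obj M g w"
    using trs_kkt_obj_diff[OF assms(1,3) \<open>w \<in> V\<close> \<open>norm w = r\<close>] by linarith
qed

text \<open>Adding the two expressions of \<open>trs_kkt_obj_diff\<close> for the two KKT points gives
  \<open>(l\<^sub>1 - l\<^sub>2) \<parallel>u\<^sub>2 - u\<^sub>1\<parallel>\<^sup>2 = -2 \<cdot> shifted_form M l\<^sub>1 (u\<^sub>2 - u\<^sub>1) \<le> 0\<close>.\<close>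

lemma trs_kkt_psd_multiplier_le:
  fixes M :: "real^'n^'n"
  assumes sym: "transpose M = M" and "subspace V" "r > 0"
    and kkt1: "trs_kkt M g V r l\<^sub>1 u\<^sub>1" and kkt2: "trs_kkt M g V r l\<^sub>2 u\<^sub>2" and psd: "psd_on M l\<^sub>1 V"
  shows "l\<^sub>1 \<le> l\<^sub>2"
proof (cases "u\<^sub>1 = u\<^sub>2")
  case True
  have "u\<^sub>1 \<bullet> (M *v u\<^sub>1 - l\<^sub>1 *\<^sub>R u\<^sub>1 + g) = 0" "u\<^sub>1 \<bullet> (M *v u\<^sub>1 - l\<^sub>2 *\<^sub>R u\<^sub>1 + g) = 0"
    using kkt1 kkt2 True unfolding trs_kkt_def by auto
  then have "(l\<^sub>2 - l\<^sub>1) * (u\<^sub>1 \<bullet> u\<^sub>1) = 0"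
    by (simp add: inner_diff_right inner_add_right algebra_simps) argo
  moreover have "u\<^sub>1 \<bullet> u\<^sub>1 > 0"
    using kkt1 \<open>r > 0\<close> unfolding trs_kkt_def by auto
  ultimately show ?thesis by simp
next
  case False
  define d where "d = u\<^sub>2 - u\<^sub>1"
  have u: "u\<^sub>1 \<in> V" "norm u\<^sub>1 = r" "u\<^sub>2 \<in> V" "norm u\<^sub>2 = r"
    using kkt1 kkt2 unfolding trs_kkt_def by auto
  have "shifted_form M l\<^sub>1 d + shifted_form M l\<^sub>2 (- d) = 0"
    using trs_kkt_obj_diff[OF sym kkt1 u(3,4)] trs_kkt_obj_diff[OF sym kkt2 u(1,2)]
    unfolding d_def by simp
  then have "2 * shifted_form M l\<^sub>1 d = (l\<^sub>2 - l\<^sub>1) * (d \<bullet> d)"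
    by (simp add: shifted_form_def matrix_vector_mult_minus algebra_simps)
  moreover have "0 \<le> shifted_form M l\<^sub>1 d"
    using psd u \<open>subspace V\<close> unfolding psd_on_def d_def by (simp add: subspace_diff)
  moreover have "d \<bullet> d > 0"
    using False unfolding d_def by simp
  ultimately show ?thesis
    using zero_le_mult_iff[of "l\<^sub>2 - l\<^sub>1" "d \<bullet> d"] by linarith
qed

lemma psd_on_shifted_form_zero_imp_orthogonal:
  fixes M :: "real^'n^'n"
  assumes "transpose M = M" "subspace V" "psd_on M l V" "z \<in> V" "shifted_form M l z = 0" "w \<in> V"
  shows "w \<bullet> (M *v z - l *\<^sub>R z) = 0"
proof -
  have "0 \<le> (2 * (w \<bullet> (M *v z - l *\<^sub>R z))) * t + shifted_form M l w * t\<^sup>2" for t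
  proof -
    have "0 \<le> shifted_form M l (z + t *\<^sub>R w)"
      using assms(2-4,6) by (simp add: psd_on_def subspace_add subspace_scale)
    then show ?thesis
      using assms(5) by (simp add: shifted_form_add_scaled[OF assms(1)] algebra_simps)
  qed
  then show ?thesis
    using quadratic_nonneg_imp_linear_coeff_zero by fastforce
qed

lemma trs_minimizer_exists:
  fixes M :: "real^'n^'n"
  assumes "subspace V" "v \<in> V" "v \<noteq> 0" "0 \<le> r"
  shows "\<exists>u. trs_minimizer M g V r u"
proof -
  have "compact (V \<inter> sphere 0 r)"
    using assms(1) by (intro closed_Int_compact closed_subspace compact_sphere)
  moreover have "(r / norm v) *\<^sub>R v \<in> V \<inter> sphere 0 r"
    using assms by (simp add: subspace_scale)
  then have "V \<inter> sphere 0 r \<noteq> {}" by blast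
  moreover have "continuous_on (V \<inter> sphere 0 r) (trs_obj M g)"
    unfolding trs_obj_def by (intro continuous_intros)
  ultimately obtain u where "u \<in> V \<inter> sphere 0 r"
    and "\<forall>w \<in> V \<inter> sphere 0 r. trs_obj M g u \<le> trs_obj M g w"
    using continuous_attains_inf by blast
  then show ?thesis
    unfolding trs_minimizer_def by auto
qed

text \<open>The reflection of a minimiser \<open>u\<close> in the hyperplane orthogonal to \<open>w\<close> stays on the sphere,
  so it cannot decrease the objective; clearing the denominators gives a polynomial inequality.\<close>

lemma trs_minimizer_reflection_ineq:
  fixes M :: "real^'n^'n"
  assumes sym: "transpose M = M" and V: "subspace V" and min: "trs_minimizer M g V r u"
    and w: "w \<in> V"
  shows "0 \<le> (u \<bullet> w)\<^sup>2 * (w \<bullet> (M *v w)) - (u \<bullet> w) * (w \<bullet> w) * (w \<bullet> (M *v u + g))"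
proof (cases "w = 0")
  case False
  define t where "t = 2 * (u \<bullet> w) / (w \<bullet> w)"
  have u: "u \<in> V" "norm u = r" "\<forall>w\<in>V. norm w = r \<longrightarrow> trs_obj M g u \<le> trs_obj M g w"
    using min unfolding trs_minimizer_def by auto
  then have "trs_obj M g u \<le> trs_obj M g (u - t *\<^sub>R w)"
    using V w norm_reflection[OF False, of u] by (simp add: t_def subspace_diff subspace_scale)
  then have "0 \<le> t\<^sup>2 * (w \<bullet> (M *v w)) - 2 * t * (w \<bullet> (M *v u + g))"
    using trs_obj_diff_scaled[OF sym, of g u t w] by linarith
  then have "0 \<le> ((w \<bullet> w)\<^sup>2 / 4) * (t\<^sup>2 * (w \<bullet> (M *v w)) - 2 * t * (w \<bullet> (M *v u + g)))"
    by simp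
  also have "\<dots> = (u \<bullet> w)\<^sup>2 * (w \<bullet> (M *v w)) - (u \<bullet> w) * (w \<bullet> w) * (w \<bullet> (M *v u + g))"
    using False by (simp add: t_def field_simps power2_eq_square)
  finally show ?thesis .
qed simp

lemma trs_minimizer_residual_orthogonal:
  fixes M :: "real^'n^'n"
  assumes sym: "transpose M = M" and V: "subspace V" and "0 < r" and min: "trs_minimizer M g V r u"
    and e: "e \<in> V" "e \<bullet> u = 0"
  shows "e \<bullet> (M *v u + g) = 0"
proof -
  have u: "u \<in> V" and uu: "u \<bullet> u = r\<^sup>2"
    using min by (auto simp: trs_minimizer_def dot_square_norm)
  define E \<sigma> \<rho> where "E = e \<bullet> e" and "\<sigma> = e \<bullet> (M *v u + g)" and "\<rho> = u \<bullet> (M *v u + g)"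
  have "0 \<le> r\<^sup>2 * r\<^sup>2 * (u \<bullet> (M *v u)) - r\<^sup>2 * r\<^sup>2 * \<rho>
      + (2 * r\<^sup>2 * r\<^sup>2 * (e \<bullet> (M *v u)) - r\<^sup>2 * r\<^sup>2 * \<sigma>) * y
      + (r\<^sup>2 * r\<^sup>2 * (e \<bullet> (M *v e)) - r\<^sup>2 * E * \<rho>) * y\<^sup>2
      + (- r\<^sup>2 * E * \<sigma>) * y ^ 3" for y
  proof -
    define w where "w = u + y *\<^sub>R e"
    have "u \<bullet> w = r\<^sup>2" "w \<bullet> w = r\<^sup>2 + y\<^sup>2 * E"
      using uu e(2) by (simp_all add: w_def E_def inner_add_right inner_add_left inner_commute power2_eq_square)
    moreover have "w \<bullet> (M *v u + g) = \<rho> + y * \<sigma>"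
      by (simp add: w_def \<rho>_def \<sigma>_def inner_add_left)
    moreover have "w \<bullet> (M *v w) = u \<bullet> (M *v u) + 2 * y * (e \<bullet> (M *v u)) + y\<^sup>2 * (e \<bullet> (M *v e))"
      using symmetric_quadratic_add[OF sym, of u "y *\<^sub>R e"]
      by (simp add: w_def matrix_vector_mult_scaleR power2_eq_square)
    moreover have "w \<in> V"
      using V u e by (simp add: w_def subspace_add subspace_scale)
    ultimately show ?thesis
      using trs_minimizer_reflection_ineq[OF sym V min, of w]
      by (simp add: algebra_simps power2_eq_square power3_eq_cube)
  qed
  then have "- r\<^sup>2 * E * \<sigma> = 0"
    by (rule cubic_nonneg_imp_leading_coeff_zero)
  then show ?thesis
    using \<open>0 < r\<close> by (auto simp: E_def \<sigma>_def)
qed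

lemma trs_minimizer_kkt:
  fixes M :: "real^'n^'n"
  assumes sym: "transpose M = M" and V: "subspace V" and "0 < r" and min: "trs_minimizer M g V r u"
  shows "trs_kkt M g V r ((u \<bullet> (M *v u + g)) / r\<^sup>2) u"
proof -
  define l where "l = (u \<bullet> (M *v u + g)) / r\<^sup>2"
  define s where "s = M *v u - l *\<^sub>R u + g"
  have u: "u \<in> V" "norm u = r" and uu: "u \<bullet> u = r\<^sup>2"
    using min by (auto simp: trs_minimizer_def dot_square_norm)
  have us: "u \<bullet> s = 0"
    using \<open>0 < r\<close> uu by (simp add: s_def l_def inner_add_right inner_diff_right)
  have "w \<bullet> s = 0" if "w \<in> V" for w
  proof -
    define e where "e = w - ((w \<bullet> u) / r\<^sup>2) *\<^sub>R u"
    have "e \<in> V"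
      using V that u by (simp add: e_def subspace_diff subspace_scale)
    moreover have "e \<bullet> u = 0"
      using \<open>0 < r\<close> uu by (simp add: e_def inner_diff_left)
    ultimately have "e \<bullet> s = 0"
      using trs_minimizer_residual_orthogonal[OF sym V \<open>0 < r\<close> min]
      by (simp add: s_def inner_add_right inner_diff_right)
    moreover have "w = e + ((w \<bullet> u) / r\<^sup>2) *\<^sub>R u"
      by (simp add: e_def)
    ultimately show ?thesis
      using us by (metis inner_add_left inner_scaleR_left mult_zero_right add_0)
  qed
  then show ?thesis
    using u by (simp add: trs_kkt_def s_def l_def)
qed

lemma trs_minimizer_psd:
  fixes M :: "real^'n^'n"
  assumes sym: "transpose M = M" and V: "subspace V" and "0 < r"
    and min: "trs_minimizer M g V r u" and kkt: "trs_kkt M g V r l u"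
  shows "psd_on M l V"
proof -
  have u: "u \<in> V" "u \<bullet> u = r\<^sup>2"
    using min by (auto simp: trs_minimizer_def dot_square_norm)
  have stat: "z \<bullet> (M *v u + g) = l * (z \<bullet> u)" if "z \<in> V" for z
    using kkt that unfolding trs_kkt_def by (auto simp: inner_add_right inner_diff_right)
  have nonneg: "0 \<le> shifted_form M l z" if z: "z \<in> V" "z \<bullet> u \<noteq> 0" for z
  proof -
    have "(u \<bullet> z)\<^sup>2 * shifted_form M l z
        = (u \<bullet> z)\<^sup>2 * (z \<bullet> (M *v z)) - (u \<bullet> z) * (z \<bullet> z) * (z \<bullet> (M *v u + g))"
      unfolding stat[OF z(1)] by (simp add: shifted_form_def inner_commute[of u z] algebra_simps power2_eq_square)
    then have "0 \<le> (u \<bullet> z)\<^sup>2 * shifted_form M l z"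
      using trs_minimizer_reflection_ineq[OF sym V min z(1)] by simp
    moreover have "0 < (u \<bullet> z)\<^sup>2"
      using z(2) by (simp add: inner_commute)
    ultimately show ?thesis
      by (simp add: zero_le_mult_iff)
  qed
  show ?thesis
    unfolding psd_on_def
  proof
    fix e assume e: "e \<in> V"
    show "0 \<le> shifted_form M l e"
    proof (cases "e \<bullet> u = 0")
      case True
      have "0 \<le> shifted_form M l e + 2 * (u \<bullet> (M *v e - l *\<^sub>R e)) * y + shifted_form M l u * y\<^sup>2"
        if "y \<noteq> 0" for y
      proof -
        have "e + y *\<^sub>R u \<in> V"
          using V e u by (simp add: subspace_add subspace_scale)
        moreover have "(e + y *\<^sub>R u) \<bullet> u \<noteq> 0"
          using True that u \<open>0 < r\<close> by (simp add: inner_add_left)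
        ultimately have "0 \<le> shifted_form M l (e + y *\<^sub>R u)"
          by (rule nonneg)
        then show ?thesis
          by (simp add: shifted_form_add_scaled[OF sym] algebra_simps)
      qed
      then show ?thesis
        by (rule quadratic_nonneg_off_zero_imp_const_nonneg)
    qed (use nonneg e in blast)
  qed
qed

lemma trs_kkt_psd_exists:
  fixes M :: "real^'n^'n"
  assumes sym: "transpose M = M" and V: "subspace V" "v \<in> V" "v \<noteq> 0" and "0 < r"
  shows "\<exists>l u. trs_kkt M g V r l u \<and> psd_on M l V"
proof -
  obtain u where min: "trs_minimizer M g V r u"
    using trs_minimizer_exists[OF V] \<open>0 < r\<close> by fastforce
  then have "trs_kkt M g V r ((u \<bullet> (M *v u + g)) / r\<^sup>2) u"
    by (rule trs_minimizer_kkt[OF sym V(1) \<open>0 < r\<close>])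
  then show ?thesis
    using trs_minimizer_psd[OF sym V(1) \<open>0 < r\<close> min] by blast
qed

lemma trs_least_multiplier_psd:
  fixes M :: "real^'n^'n"
  assumes sym: "transpose M = M" and V: "subspace V" "v \<in> V" "v \<noteq> 0" and "0 < r"
    and kkt: "trs_kkt M g V r l u" and least: "\<And>l' u'. trs_kkt M g V r l' u' \<Longrightarrow> l \<le> l'"
  shows "psd_on M l V"
proof -
  obtain l' u' where kkt': "trs_kkt M g V r l' u'" and psd: "psd_on M l' V"
    using trs_kkt_psd_exists[OF sym V \<open>0 < r\<close>] by blast
  have "l' \<le> l"
    by (rule trs_kkt_psd_multiplier_le[OF sym V(1) \<open>0 < r\<close> kkt' kkt psd])
  with least[OF kkt'] psd show ?thesis
    by simp
qed

lemma trs_subspace_restriction: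
  fixes M :: "real^'n^'n"
  assumes sym: "transpose M = M" and U: "subspace U" "U \<subseteq> V"
    and kkt: "trs_kkt M g V r l u" and kkt_U: "trs_kkt M g U r l' u'" and psd_U: "psd_on M l' U"
    and w: "w \<in> U" "norm w = r"
  shows "trs_obj M g u' - trs_obj M g u = shifted_form M l (u' - u)"
    and "shifted_form M l (u' - u) \<le> shifted_form M l (w - u)"
    and "(l' - l) * r\<^sup>2 = shifted_form M l (u' - u) - g \<bullet> (u' - u)"
proof -
  have "u' \<in> V" "norm u' = r"
    using kkt_U U(2) by (auto simp: trs_kkt_def)
  then show diff: "trs_obj M g u' - trs_obj M g u = shifted_form M l (u' - u)"
    by (rule trs_kkt_obj_diff[OF sym kkt])
  have "trs_obj M g u' \<le> trs_obj M g w"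
    using trs_kkt_psd_imp_minimizer[OF sym U(1) kkt_U psd_U] w by (simp add: trs_minimizer_def)
  moreover have "trs_obj M g w - trs_obj M g u = shifted_form M l (w - u)"
    using w U(2) by (intro trs_kkt_obj_diff[OF sym kkt]) auto
  ultimately show "shifted_form M l (u' - u) \<le> shifted_form M l (w - u)"
    using diff by linarith
  show "(l' - l) * r\<^sup>2 = shifted_form M l (u' - u) - g \<bullet> (u' - u)"
    using diff trs_kkt_multiplier_eq[OF kkt] trs_kkt_multiplier_eq[OF kkt_U]
    by (simp add: inner_diff_right left_diff_distrib)
qed

section \<open>Eigenvalue bounds for symmetric matrices\<close>

lemma uminus_matrix_vector_mult: "(- A) *v x = - (A *v (x::real^'m))" for A :: "real^'m^'n"
  by (simp add: matrix_vector_mult_def vec_eq_iff sum_negf)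

lemma transpose_uminus: "transpose (- A) = - transpose (A::real^'m^'n)"
  by (simp add: transpose_def vec_eq_iff)

text \<open>The smallest eigenvalue comes from the trust-region subproblem with \<open>g = 0\<close> on the
  whole space, i.e. from a minimiser of the Rayleigh quotient.\<close>

lemma symmetric_eigval_lower_bound:
  fixes H :: "real^'k^'k"
  assumes "transpose H = H"
  shows "\<exists>l\<in>eigvals H. \<forall>y. l * (y \<bullet> y) \<le> y \<bullet> (H *v y)"
proof -
  have "(axis undefined 1 :: real^'k) \<noteq> 0"
    by (simp add: axis_eq_0_iff)
  from trs_kkt_psd_exists[OF assms subspace_UNIV UNIV_I this, where r = 1 and g = 0]
  obtain l u where kkt: "trs_kkt H 0 UNIV 1 l u" and psd: "psd_on H l UNIV"
    by auto
  then have "u \<noteq> 0" and "(H *v u - l *\<^sub>R u) \<bullet> (H *v u - l *\<^sub>R u) = 0"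
    by (auto simp: trs_kkt_def)
  then have "l \<in> eigvals H"
    unfolding eigvals_def by auto
  moreover have "l * (y \<bullet> y) \<le> y \<bullet> (H *v y)" for y
    using psd by (simp add: psd_on_def shifted_form_def)
  ultimately show ?thesis
    by blast
qed

lemma symmetric_eigvals_finite:
  fixes H :: "real^'k^'k"
  assumes sym: "transpose H = H"
  shows "finite (eigvals H)"
proof -
  define e where "e t = (SOME x. x \<noteq> 0 \<and> H *v x = t *\<^sub>R x)" for t
  have e: "e t \<noteq> 0 \<and> H *v e t = t *\<^sub>R e t" if "t \<in> eigvals H" for t
    using that unfolding eigvals_def e_def by (rule CollectE) (rule someI_ex)
  have "inj_on e (eigvals H)"
  proof (rule inj_onI)
    fix s t assume "s \<in> eigvals H" "t \<in> eigvals H" "e s = e t"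
    then have "s *\<^sub>R e s = t *\<^sub>R e s" "e s \<noteq> 0"
      using e by metis+
    then show "s = t" by simp
  qed
  moreover have "pairwise orthogonal (e ` eigvals H)"
    unfolding pairwise_def orthogonal_def
  proof (intro ballI impI)
    fix x y assume "x \<in> e ` eigvals H" "y \<in> e ` eigvals H" "x \<noteq> y"
    then obtain s t where s: "s \<in> eigvals H" "x = e s" and t: "t \<in> eigvals H" "y = e t" and "s \<noteq> t"
      by auto
    have "s * (x \<bullet> y) = y \<bullet> (H *v x)"
      using e[OF s(1)] s(2) by (simp add: inner_commute)
    also have "\<dots> = x \<bullet> (H *v y)"
      by (rule symmetric_matrix_inner[OF sym, symmetric])
    also have "\<dots> = t * (x \<bullet> y)"
      using e[OF t(1)] t(2) by simp
    finally show "x \<bullet> y = 0"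
      using \<open>s \<noteq> t\<close> by simp
  qed
  then have "finite (e ` eigvals H)"
    by (rule pairwise_orthogonal_imp_finite)
  ultimately show ?thesis
    using finite_imageD by blast
qed

lemma symmetric_eigval_upper_bound:
  fixes H :: "real^'k^'k"
  assumes "transpose H = H"
  shows "\<exists>l\<in>eigvals H. \<forall>y. y \<bullet> (H *v y) \<le> l * (y \<bullet> y)"
proof -
  have "transpose (- H) = - H"
    using assms by (simp add: transpose_uminus)
  then obtain l where l: "l \<in> eigvals (- H)" "\<And>y. l * (y \<bullet> y) \<le> y \<bullet> ((- H) *v y)"
    using symmetric_eigval_lower_bound by blast
  obtain x where x: "x \<noteq> 0" "(- H) *v x = l *\<^sub>R x"
    using l(1) unfolding eigvals_def by blast
  have "H *v x = - ((- H) *v x)"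
    by (simp add: uminus_matrix_vector_mult)
  also have "\<dots> = (- l) *\<^sub>R x"
    using x(2) by simp
  finally have "- l \<in> eigvals H"
    using x(1) unfolding eigvals_def by blast
  moreover have "y \<bullet> (H *v y) \<le> - l * (y \<bullet> y)" for y
    using l(2)[of y] by (simp add: uminus_matrix_vector_mult)
  ultimately show ?thesis
    by blast
qed

lemma symmetric_rayleigh_bounds:
  fixes H :: "real^'k^'k"
  assumes sym: "transpose H = H"
  shows "Min (eigvals H) \<in> eigvals H"
    and "Min (eigvals H) * (y \<bullet> y) \<le> y \<bullet> (H *v y)"
    and "y \<bullet> (H *v y) \<le> Max (eigvals H) * (y \<bullet> y)"
    and "Min (eigvals H) \<le> Max (eigvals H)"
proof -
  have fin: "finite (eigvals H)"
    by (rule symmetric_eigvals_finite[OF sym])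
  obtain l where l: "l \<in> eigvals H" "\<And>y. l * (y \<bullet> y) \<le> y \<bullet> (H *v y)"
    using symmetric_eigval_lower_bound[OF sym] by blast
  obtain l' where l': "l' \<in> eigvals H" "\<And>y. y \<bullet> (H *v y) \<le> l' * (y \<bullet> y)"
    using symmetric_eigval_upper_bound[OF sym] by blast
  show Min: "Min (eigvals H) \<in> eigvals H"
    using fin l(1) by (intro Min_in) auto
  then show "Min (eigvals H) \<le> Max (eigvals H)"
    using fin by (rule Max_ge[rotated])
  have "Min (eigvals H) * (y \<bullet> y) \<le> l * (y \<bullet> y)"
    using fin l(1) by (intro mult_right_mono) auto
  with l(2)[of y] show "Min (eigvals H) * (y \<bullet> y) \<le> y \<bullet> (H *v y)"
    by linarith
  have "l' * (y \<bullet> y) \<le> Max (eigvals H) * (y \<bullet> y)"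
    using fin l'(1) by (intro mult_right_mono) auto
  with l'(2)[of y] show "y \<bullet> (H *v y) \<le> Max (eigvals H) * (y \<bullet> y)"
    by linarith
qed

section \<open>The Lanczos process\<close>

text \<open>\<open>lanczos_q M b j\<close> is \<open>q\<^sub>j\<close> for every \<open>j\<close>, including \<open>q\<^sub>0 = 0\<close>, whereas \<open>lq M b 0\<close> is \<open>q\<^sub>1\<close>.
  \<open>lanczos_residual M b i\<close> is \<open>q\<^sub>i\<^sub>+\<^sub>2\<close> before normalisation.\<close>

definition lanczos_q :: "real^'n^'n \<Rightarrow> real^'n \<Rightarrow> nat \<Rightarrow> real^'n" where
  "lanczos_q M b j = fst (lanczos M b j)"

definition lanczos_residual :: "real^'n^'n \<Rightarrow> real^'n \<Rightarrow> nat \<Rightarrow> real^'n" where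
  "lanczos_residual M b i =
     M *v lanczos_q M b (Suc i)
     - (lanczos_q M b (Suc i) \<bullet> (M *v lanczos_q M b (Suc i))) *\<^sub>R lanczos_q M b (Suc i)
     - lbeta M b (Suc i) *\<^sub>R lanczos_q M b i"

lemma lanczos_q_0 [simp]: "lanczos_q M b 0 = 0"
  by (simp add: lanczos_q_def)

lemma lanczos_q_Suc: "lanczos_q M b (Suc j) = fst (snd (lanczos M b j))"
  by (cases "lanczos M b j") (simp add: lanczos_q_def Let_def)

lemma lanczos_q_1: "lanczos_q M b (Suc 0) = b /\<^sub>R norm b"
  by (simp add: lanczos_q_Suc)

lemma lq_eq_lanczos_q: "1 \<le> j \<Longrightarrow> lq M b j = lanczos_q M b j"
  by (cases j) (auto simp: lq_def lanczos_q_Suc)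

lemma lanczos_q_Suc_Suc: "lanczos_q M b (Suc (Suc i)) = lanczos_residual M b i /\<^sub>R norm (lanczos_residual M b i)"
  and lbeta_Suc_Suc: "lbeta M b (Suc (Suc i)) = norm (lanczos_residual M b i)"
proof -
  obtain qp q be where e: "lanczos M b i = (qp, q, be)"
    by (cases "lanczos M b i") auto
  have "lanczos_q M b i = qp" "lanczos_q M b (Suc i) = q" "lbeta M b (Suc i) = be"
    using e by (simp_all add: lanczos_q_def lanczos_q_Suc lbeta_def Let_def)
  with e show "lanczos_q M b (Suc (Suc i)) = lanczos_residual M b i /\<^sub>R norm (lanczos_residual M b i)"
    and "lbeta M b (Suc (Suc i)) = norm (lanczos_residual M b i)"
    by (simp_all add: lanczos_q_Suc lbeta_def lanczos_residual_def Let_def)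
qed

lemma lanczos_residual_eq: "lanczos_residual M b i = lbeta M b (Suc (Suc i)) *\<^sub>R lanczos_q M b (Suc (Suc i))"
  by (cases "lanczos_residual M b i = 0") (simp_all add: lanczos_q_Suc_Suc lbeta_Suc_Suc)

lemma lanczos_three_term:
  "M *v lanczos_q M b (Suc i) =
     lbeta M b (Suc (Suc i)) *\<^sub>R lanczos_q M b (Suc (Suc i))
     + (lanczos_q M b (Suc i) \<bullet> (M *v lanczos_q M b (Suc i))) *\<^sub>R lanczos_q M b (Suc i)
     + lbeta M b (Suc i) *\<^sub>R lanczos_q M b i"
  using lanczos_residual_eq[of M b i] by (simp add: lanczos_residual_def algebra_simps)

lemma lanczos_q_in_invariant_subspace:
  assumes V: "subspace V" and "b \<in> V" and MV: "\<And>x. x \<in> V \<Longrightarrow> M *v x \<in> V"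
  shows "lanczos_q M b j \<in> V"
proof -
  have "lanczos_q M b j \<in> V \<and> lanczos_q M b (Suc j) \<in> V"
  proof (induction j)
    case 0
    show ?case
      using V \<open>b \<in> V\<close> by (simp add: lanczos_q_1 subspace_0 subspace_scale)
  next
    case (Suc j)
    then have "lanczos_residual M b j \<in> V"
      unfolding lanczos_residual_def using V MV by (intro subspace_diff subspace_scale) auto
    with Suc V show ?case
      by (simp add: lanczos_q_Suc_Suc subspace_scale)
  qed
  then show ?thesis ..
qed

lemma lanczos_residual_orthogonal:
  fixes M :: "real^'n^'n"
  assumes sym: "transpose M = M"
    and orth: "\<And>i j. i \<le> Suc k \<Longrightarrow> j \<le> Suc k \<Longrightarrow>
      lanczos_q M b i \<bullet> lanczos_q M b j = (if i = j \<and> 1 \<le> i then 1 else 0)"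
    and "j \<le> Suc k"
  shows "lanczos_residual M b k \<bullet> lanczos_q M b j = 0"
proof -
  let ?q = "lanczos_q M b"
  have residual: "lanczos_residual M b k \<bullet> ?q j
      = ?q (Suc k) \<bullet> (M *v ?q j) - (?q (Suc k) \<bullet> (M *v ?q (Suc k))) * (?q (Suc k) \<bullet> ?q j)
        - lbeta M b (Suc k) * (?q k \<bullet> ?q j)"
    using symmetric_matrix_inner[OF sym, of "?q j" "?q (Suc k)"]
    by (simp add: lanczos_residual_def inner_diff_left inner_commute[of "M *v ?q (Suc k)"])
  consider "j = 0" | "j = Suc k" | j' where "j = Suc j'" "j' < k"
    using \<open>j \<le> Suc k\<close> by (cases j) (auto simp: le_less)
  then show ?thesis
  proof cases
    case 1
    then show ?thesis by simp
  next
    case 2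
    then show ?thesis
      using residual orth[of k "Suc k"] orth[of "Suc k" "Suc k"] by simp
  next
    case 3
    then have "?q (Suc k) \<bullet> (M *v ?q j)
        = lbeta M b (Suc j) * (?q (Suc k) \<bullet> ?q (Suc j)) + lbeta M b j * (?q (Suc k) \<bullet> ?q j')"
      using orth[of "Suc k" j] by (simp only:) (subst lanczos_three_term, simp add: inner_add_right)
    then show ?thesis
      using residual orth[of "Suc k" "Suc j"] orth[of "Suc k" j'] orth[of "Suc k" j] orth[of k j] 3
      by (cases "Suc j = k") auto
  qed
qed

lemma lanczos_orthonormal:
  fixes M :: "real^'n^'n"
  assumes sym: "transpose M = M" and "b \<noteq> 0"
    and no_breakdown: "\<And>j. 1 \<le> j \<Longrightarrow> j < K \<Longrightarrow> lbeta M b (Suc j) \<noteq> 0"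
    and "J \<le> K" "i \<le> J" "j \<le> J"
  shows "lanczos_q M b i \<bullet> lanczos_q M b j = (if i = j \<and> 1 \<le> i then 1 else 0)"
proof -
  have "\<forall>i\<le>J. \<forall>j\<le>J. lanczos_q M b i \<bullet> lanczos_q M b j = (if i = j \<and> 1 \<le> i then 1 else 0)"
    using \<open>J \<le> K\<close>
  proof (induction J)
    case 0
    then show ?case by simp
  next
    case (Suc J)
    show ?case
    proof (cases J)
      case 0
      have "lanczos_q M b 1 \<bullet> lanczos_q M b 1 = 1"
        using \<open>b \<noteq> 0\<close> by (simp add: lanczos_q_1 dot_square_norm power2_eq_square)
      with 0 show ?thesis
        by (auto simp: le_Suc_eq)
    next
      case (Suc k)
      let ?q = "lanczos_q M b"
      have orth: "?q i \<bullet> ?q j = (if i = j \<and> 1 \<le> i then 1 else 0)" if "i \<le> Suc k" "j \<le> Suc k" for i j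
        using Suc.IH Suc.prems that \<open>J = Suc k\<close> by simp
      have "lanczos_residual M b k \<noteq> 0"
        using no_breakdown[of "Suc k"] Suc.prems \<open>J = Suc k\<close> by (simp add: lbeta_Suc_Suc)
      then have new: "?q (Suc (Suc k)) \<bullet> ?q (Suc (Suc k)) = 1"
        by (simp add: lanczos_q_Suc_Suc dot_square_norm)
      have old: "?q (Suc (Suc k)) \<bullet> ?q j = 0" if "j \<le> Suc k" for j
        using lanczos_residual_orthogonal[OF sym orth that] by (simp add: lanczos_q_Suc_Suc)
      show ?thesis
        unfolding \<open>J = Suc k\<close>
      proof (intro allI impI)
        fix i j assume "i \<le> Suc (Suc k)" "j \<le> Suc (Suc k)"
        then consider "i \<le> Suc k" "j \<le> Suc k" | "i = Suc (Suc k)" "j \<le> Suc k"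
          | "i \<le> Suc k" "j = Suc (Suc k)" | "i = Suc (Suc k)" "j = Suc (Suc k)"
          by (auto simp: le_Suc_eq)
        then show "?q i \<bullet> ?q j = (if i = j \<and> 1 \<le> i then 1 else 0)"
        proof cases
          case 3
          then show ?thesis
            using old[of i] by (simp add: inner_commute)
        qed (simp_all add: orth old new)
      qed
    qed
  qed
  with assms(5,6) show ?thesis by blast
qed

lemma lanczos_matrix_step:
  assumes "x \<in> span (lanczos_q M b ` {1..n})"
  shows "M *v x \<in> span (lanczos_q M b ` {1..Suc n})"
proof -
  let ?T = "span (lanczos_q M b ` {1..Suc n})"
  have q: "lanczos_q M b l \<in> ?T" if "l \<le> Suc n" for l
    using that by (cases l) (auto intro: span_base span_zero)
  have "span (lanczos_q M b ` {1..n}) \<subseteq> {x. M *v x \<in> ?T}"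
  proof (rule span_minimal)
    show "lanczos_q M b ` {1..n} \<subseteq> {x. M *v x \<in> ?T}"
    proof clarify
      fix j assume "j \<in> {1..n}"
      then obtain j' where "j = Suc j'" "j' < n"
        by (cases j) auto
      then show "M *v lanczos_q M b j \<in> ?T"
        by (simp only:) (subst lanczos_three_term, intro span_add span_scale q, simp_all)
    qed
    show "subspace {x. M *v x \<in> ?T}"
      by (auto simp: subspace_def matrix_vector_right_distrib matrix_vector_mult_scaleR span_add
          span_scale span_zero)
  qed
  with assms show ?thesis by blast
qed

lemma krylov_subset_span_lanczos: "krylov M b k \<subseteq> span (lanczos_q M b ` {1..k})"
  unfolding krylov_def
proof (rule span_minimal)
  have "(((*v) M) ^^ i) b \<in> span (lanczos_q M b ` {1..Suc i})" for i
  proof (induction i)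
    case 0
    have "b = norm b *\<^sub>R lanczos_q M b (Suc 0)"
      by (cases "b = 0") (simp_all add: lanczos_q_1)
    also have "\<dots> \<in> span (lanczos_q M b ` {1..Suc 0})"
      by (intro span_scale span_base) auto
    finally show ?case by simp
  next
    case (Suc i)
    then show ?case
      using lanczos_matrix_step by simp
  qed
  moreover have "span (lanczos_q M b ` {1..Suc i}) \<subseteq> span (lanczos_q M b ` {1..k})" if "i < k" for i
    using that by (intro span_mono image_mono) auto
  ultimately show "(\<lambda>i. (((*v) M) ^^ i) b) ` {..<k} \<subseteq> span (lanczos_q M b ` {1..k})"
    by blast
qed (rule subspace_span)

section \<open>rLGopt as a trust-region subproblem\<close>

lemma orthonormal_sum_coord:
  fixes q :: "'i \<Rightarrow> 'a::real_inner"
  assumes orth: "\<And>i j. i \<in> I \<Longrightarrow> j \<in> I \<Longrightarrow> q i \<bullet> q j = (if i = j then 1 else 0)"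
    and "finite I" "i \<in> I"
  shows "q i \<bullet> (\<Sum>j\<in>I. x j *\<^sub>R q j) = x i"
proof -
  have "q i \<bullet> (\<Sum>j\<in>I. x j *\<^sub>R q j) = (\<Sum>j\<in>I. x j * (q i \<bullet> q j))"
    by (simp add: inner_sum_right)
  also have "\<dots> = (\<Sum>j\<in>I. if i = j then x j else 0)"
    by (rule sum.cong) (auto simp: orth[OF \<open>i \<in> I\<close>])
  also have "\<dots> = x i"
    using assms(2,3) by (simp add: sum.delta)
  finally show ?thesis .
qed

lemma orthonormal_sum_inner_self:
  fixes q :: "'i \<Rightarrow> 'a::real_inner"
  assumes orth: "\<And>i j. i \<in> I \<Longrightarrow> j \<in> I \<Longrightarrow> q i \<bullet> q j = (if i = j then 1 else 0)"
    and "finite I"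
  shows "(\<Sum>j\<in>I. x j *\<^sub>R q j) \<bullet> (\<Sum>j\<in>I. x j *\<^sub>R q j) = (\<Sum>i\<in>I. (x i)\<^sup>2)"
  using orthonormal_sum_coord[OF orth \<open>finite I\<close>]
  by (simp add: inner_sum_left power2_eq_square)

lemma orthonormal_span_expansion:
  fixes q :: "'i \<Rightarrow> 'a::real_inner"
  assumes orth: "\<And>i j. i \<in> I \<Longrightarrow> j \<in> I \<Longrightarrow> q i \<bullet> q j = (if i = j then 1 else 0)"
    and "finite I" "u \<in> span (q ` I)"
  shows "u = (\<Sum>j\<in>I. (q j \<bullet> u) *\<^sub>R q j)"
proof -
  have lin: "linear (\<lambda>u. \<Sum>j\<in>I. (q j \<bullet> u) *\<^sub>R q j)"
    by (intro linearI) (simp_all add: inner_add_right scaleR_add_left sum.distrib scaleR_sum_right)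
  have "id v = (\<Sum>j\<in>I. (q j \<bullet> v) *\<^sub>R q j)" if v: "v \<in> q ` I" for v
  proof -
    obtain i where "i \<in> I" "v = q i"
      using v by blast
    moreover have "(\<Sum>j\<in>I. (q j \<bullet> q i) *\<^sub>R q j) = (\<Sum>j\<in>I. if j = i then q i else 0)"
      by (rule sum.cong) (auto simp: orth[OF _ \<open>i \<in> I\<close>])
    ultimately show ?thesis
      using \<open>finite I\<close> by (simp add: sum.delta')
  qed
  from linear_eq_on_span[OF linear_id lin this assms(3)] show ?thesis
    by simp
qed

lemma matrix_vector_mult_sum: "(M :: real^'n^'m) *v (\<Sum>j\<in>S. f j) = (\<Sum>j\<in>S. M *v f j)"
  by (induction S rule: infinite_finite_induct) (auto simp: matrix_vector_right_distrib)

lemma lq_inner_matrix_sum: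
  "lq M b i \<bullet> (M *v (\<Sum>j=1..k. x j *\<^sub>R lq M b j)) = (\<Sum>j=1..k. Tk M b i j * x j)"
  by (simp add: Tk_def matrix_vector_mult_sum matrix_vector_mult_scaleR inner_sum_right mult.commute)

text \<open>rLGopt is the KKT system of the trust-region subproblem on \<open>span {q\<^sub>1, \<dots>, q\<^sub>k}\<close>,
  written in the orthonormal coordinates given by the Lanczos vectors.\<close>

lemma rlg_feasible_imp_trs_kkt:
  fixes M :: "real^'n^'n"
  assumes orth: "\<And>i j. i \<in> {1..k} \<Longrightarrow> j \<in> {1..k} \<Longrightarrow> lq M b i \<bullet> lq M b j = (if i = j then 1 else 0)"
    and q1: "b = norm b *\<^sub>R lq M b 1" and "1 \<le> k"
    and feas: "rlg_feasible M b r k l x"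
  shows "trs_kkt M b (span (lq M b ` {1..k})) r l (\<Sum>j=1..k. x j *\<^sub>R lq M b j)"
proof -
  let ?q = "lq M b" and ?u = "\<Sum>j=1..k. x j *\<^sub>R lq M b j"
  define res where "res = M *v ?u - l *\<^sub>R ?u + b"
  have "?q i \<bullet> res = 0" if i: "i \<in> {1..k}" for i
  proof -
    have "?q i \<bullet> b = (if i = 1 then norm b else 0)"
      using orth[OF i, of 1] \<open>1 \<le> k\<close> by (subst q1) auto
    moreover have "(\<Sum>j=1..k. Tk M b i j * x j) - l * x i = (if i = 1 then - norm b else 0)"
      using feas i unfolding rlg_feasible_def by blast
    ultimately show ?thesis
      using lq_inner_matrix_sum[where M = M and b = b and i = i and k = k and x = x] orthonormal_sum_coord[where I = "{1..k}", OF orth _ i, where x = x]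
      by (simp add: res_def inner_diff_right inner_add_right)
  qed
  then have "span (?q ` {1..k}) \<subseteq> {w. w \<bullet> res = 0}"
    by (intro span_minimal) (auto simp: subspace_def inner_add_left)
  moreover have "?u \<in> span (?q ` {1..k})"
    by (intro span_sum span_scale span_base) auto
  moreover have "norm ?u = r"
    using feas orthonormal_sum_inner_self[where I = "{1..k}", OF orth, where x = x]
    by (simp add: rlg_feasible_def norm_eq_sqrt_inner)
  ultimately show ?thesis
    unfolding trs_kkt_def res_def by auto
qed

lemma trs_kkt_imp_rlg_feasible:
  fixes M :: "real^'n^'n"
  assumes orth: "\<And>i j. i \<in> {1..k} \<Longrightarrow> j \<in> {1..k} \<Longrightarrow> lq M b i \<bullet> lq M b j = (if i = j then 1 else 0)"
    and q1: "b = norm b *\<^sub>R lq M b 1" and "1 \<le> k"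
    and kkt: "trs_kkt M b (span (lq M b ` {1..k})) r l u"
  shows "rlg_feasible M b r k l (\<lambda>j. lq M b j \<bullet> u)"
proof -
  let ?q = "lq M b" and ?x = "\<lambda>j. lq M b j \<bullet> u"
  have u: "u \<in> span (?q ` {1..k})" "norm u = r"
    and stat: "\<forall>w\<in>span (?q ` {1..k}). w \<bullet> (M *v u - l *\<^sub>R u + b) = 0"
    using kkt unfolding trs_kkt_def by auto
  have expand: "u = (\<Sum>j=1..k. ?x j *\<^sub>R ?q j)"
    using orthonormal_span_expansion[where I = "{1..k}", OF orth _ u(1)] by simp
  have "(\<Sum>j=1..k. Tk M b i j * ?x j) - l * ?x i = (if i = 1 then - norm b else 0)"
    if i: "i \<in> {1..k}" for i
  proof -
    have "?q i \<bullet> (M *v u) = (\<Sum>j=1..k. Tk M b i j * ?x j)"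
      using lq_inner_matrix_sum[where M = M and b = b and i = i and k = k and x = ?x] expand by simp
    moreover have "?q i \<in> span (?q ` {1..k})"
      using i by (intro span_base imageI)
    then have "?q i \<bullet> (M *v u - l *\<^sub>R u + b) = 0"
      using stat by blast
    moreover have "?q i \<bullet> b = (if i = 1 then norm b else 0)"
      using orth[OF i, of 1] \<open>1 \<le> k\<close> by (subst q1) auto
    ultimately show ?thesis
      by (auto simp: inner_diff_right inner_add_right)
  qed
  moreover have "sqrt (\<Sum>i=1..k. (?x i)\<^sup>2) = r"
    using u(2) orthonormal_sum_inner_self[where I = "{1..k}", OF orth, where x = ?x] expand
    by (metis finite_atLeastAtMost norm_eq_sqrt_inner)
  ultimately show ?thesis
    unfolding rlg_feasible_def by blast
qed

lemma rlg_minimizer_imp_trs_kkt_psd: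
  fixes M :: "real^'n^'n"
  assumes sym: "transpose M = M" and "0 < r"
    and orth: "\<And>i j. i \<in> {1..k} \<Longrightarrow> j \<in> {1..k} \<Longrightarrow> lq M b i \<bullet> lq M b j = (if i = j then 1 else 0)"
    and q1: "b = norm b *\<^sub>R lq M b 1" and "1 \<le> k"
    and min: "rlg_minimizer M b r k l x"
  shows "trs_kkt M b (span (lq M b ` {1..k})) r l (\<Sum>j=1..k. x j *\<^sub>R lq M b j)"
    and "psd_on M l (span (lq M b ` {1..k}))"
proof -
  show kkt: "trs_kkt M b (span (lq M b ` {1..k})) r l (\<Sum>j=1..k. x j *\<^sub>R lq M b j)"
    using min rlg_feasible_imp_trs_kkt[OF orth q1 \<open>1 \<le> k\<close>] by (simp add: rlg_minimizer_def)
  have "lq M b 1 \<in> span (lq M b ` {1..k})" "lq M b 1 \<noteq> 0"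
    using orth[of 1 1] \<open>1 \<le> k\<close> by (auto intro: span_base)
  moreover have "l \<le> l'" if "trs_kkt M b (span (lq M b ` {1..k})) r l' u'" for l' u'
    using min trs_kkt_imp_rlg_feasible[OF orth q1 \<open>1 \<le> k\<close> that] by (auto simp: rlg_minimizer_def)
  ultimately show "psd_on M l (span (lq M b ` {1..k}))"
    using trs_least_multiplier_psd[OF sym subspace_span _ _ \<open>0 < r\<close> kkt] by blast
qed


section \<open>CRQopt, LGopt and QEPmin\<close>

declare transpose_matrix_vector [simp del]

lemma inner_transpose_matrix: "(x :: real^'m) \<bullet> (transpose C *v y) = (C *v x) \<bullet> y"
  for C :: "real^'m^'n"
  by (metis dot_lmul_matrix transpose_matrix_vector vector_transpose_matrix)

lemma orthonormal_columns_norm: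
  fixes S :: "real^'k^'n"
  assumes "transpose S ** S = mat 1"
  shows "norm (S *v z) = norm z"
proof -
  have "(S *v z) \<bullet> (S *v z) = z \<bullet> z"
    using inner_transpose_matrix[of z S "S *v z"] assms by (simp add: matrix_vector_mul_assoc)
  then show ?thesis
    by (simp add: norm_eq_sqrt_inner)
qed

lemma transpose_diff: "transpose (A - B) = transpose A - transpose (B :: real^'m^'n)"
  by (simp add: transpose_def vec_eq_iff)

lemma shifted_matrix_vector_mult: "(M - l *\<^sub>R mat 1) *v x = M *v x - l *\<^sub>R (x :: real^'n)"
  for M :: "real^'n^'n"
  by (metis matrix_vector_mul_lid matrix_vector_mult_diff_rdistrib scaleR_matrix_vector_assoc)

lemma gram_invertible:
  fixes C :: "real^'m^'n"
  assumes "rank C = CARD('m)"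
  shows "invertible (transpose C ** C)"
proof -
  have inj: "inj ((*v) C)"
    using assms full_rank_injective by blast
  have "z = 0" if "(transpose C ** C) *v z = 0" for z
  proof -
    have "(C *v z) \<bullet> (C *v z) = 0"
      using that inner_transpose_matrix[of z C "C *v z"] by (simp add: matrix_vector_mul_assoc)
    then show "z = 0"
      using inj by (metis inner_eq_zero_iff injD matrix_vector_mult_0_right)
  qed
  then have "inj ((*v) (transpose C ** C))"
    using linear_injective_0[of "(*v) (transpose C ** C)"] by auto
  then show ?thesis
    using matrix_left_invertible_injective invertible_left_inverse by blast
qed

lemma matrix_inv_inverse:
  fixes G :: "real^'m^'m"
  assumes "invertible G"
  shows "G ** matrix_inv G = mat 1" and "matrix_inv G ** G = mat 1"
proof -
  have "G ** matrix_inv G = mat 1 \<and> matrix_inv G ** G = mat 1"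
    using assms unfolding invertible_def matrix_inv_def by (rule someI_ex)
  then show "G ** matrix_inv G = mat 1" "matrix_inv G ** G = mat 1"
    by auto
qed

lemma matrix_inv_symmetric:
  fixes G :: "real^'m^'m"
  assumes "invertible G" "transpose G = G"
  shows "transpose (matrix_inv G) = matrix_inv G"
proof -
  note inv = matrix_inv_inverse[OF assms(1)]
  have "transpose (matrix_inv G) ** G = mat 1"
    using arg_cong[OF inv(1), of transpose] assms(2) by (simp add: matrix_transpose_mul)
  have "transpose (matrix_inv G) = transpose (matrix_inv G) ** (G ** matrix_inv G)"
    using inv(1) by simp
  also have "\<dots> = (transpose (matrix_inv G) ** G) ** matrix_inv G"
    by (simp add: matrix_mul_assoc)
  also have "\<dots> = matrix_inv G"
    using \<open>transpose (matrix_inv G) ** G = mat 1\<close> by simp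
  finally show ?thesis .
qed

locale crq_problem =
  fixes A :: "real^'n^'n" and C :: "real^'m^'n" and b :: "real^'m"
  assumes symmetric_A: "transpose A = A"
    and rank_C: "rank C = CARD('m)"
    and norm_n0_less_1: "norm (n0vec C b) < 1"
begin

abbreviation "Ginv \<equiv> matrix_inv (transpose C ** C)"
abbreviation "PAP \<equiv> projP C ** A ** projP C"
abbreviation "n0 \<equiv> n0vec C b"
abbreviation "b0 \<equiv> b0vec A C b"
abbreviation "\<gamma> \<equiv> gam C b"
abbreviation "V \<equiv> {y. transpose C *v y = 0}"

lemma gram_inverse:
  "(transpose C ** C) ** Ginv = mat 1" "transpose Ginv = Ginv"
proof -
  have "invertible (transpose C ** C)" "transpose (transpose C ** C) = transpose C ** C"
    by (simp_all add: gram_invertible[OF rank_C] matrix_transpose_mul)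
  then show "(transpose C ** C) ** Ginv = mat 1" "transpose Ginv = Ginv"
    by (simp_all add: matrix_inv_inverse(1) matrix_inv_symmetric)
qed

lemma projP_apply: "projP C *v x = x - C *v (Ginv *v (transpose C *v x))"
  by (simp add: projP_def matrix_vector_mult_diff_rdistrib matrix_vector_mul_assoc matrix_mul_assoc)

lemma projP_in_V: "projP C *v x \<in> V"
proof -
  have "transpose C *v (C *v (Ginv *v y)) = y" for y
    using gram_inverse(1) by (simp add: matrix_vector_mul_assoc matrix_mul_assoc)
  then show ?thesis
    by (simp add: projP_apply matrix_vector_mult_diff_distrib)
qed

lemma projP_fixes_V: "y \<in> V \<Longrightarrow> projP C *v y = y"
  by (simp add: projP_apply)

lemma projP_symmetric: "transpose (projP C) = projP C"
  using gram_inverse(2)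
  by (simp add: projP_def transpose_diff matrix_transpose_mul matrix_mul_assoc)

lemma inner_projP_V: "y \<in> V \<Longrightarrow> y \<bullet> (projP C *v z) = y \<bullet> z"
  using symmetric_matrix_inner[OF projP_symmetric, of y z] projP_fixes_V
  by (simp add: inner_commute)

lemma subspace_V: "subspace V"
  by (simp add: subspace_def matrix_vector_right_distrib matrix_vector_mult_scaleR)

lemma PAP_symmetric: "transpose PAP = PAP"
  by (simp add: matrix_transpose_mul projP_symmetric symmetric_A matrix_mul_assoc)

lemma PAP_in_V: "PAP *v x \<in> V"
  by (metis projP_in_V matrix_vector_mul_assoc)

lemma PAP_quadratic: "y \<in> V \<Longrightarrow> y \<bullet> (PAP *v y) = y \<bullet> (A *v y)"
  by (simp add: matrix_vector_mul_assoc[symmetric] inner_projP_V projP_fixes_V)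

lemma transpose_C_n0: "transpose C *v n0 = b"
  using gram_inverse(1) by (simp add: n0vec_def matrix_vector_mul_assoc matrix_mul_assoc)

lemma n0_orthogonal_V: "y \<in> V \<Longrightarrow> y \<bullet> n0 = 0"
  using inner_transpose_matrix[of "Ginv *v b" C y]
  by (simp add: n0vec_def matrix_vector_mul_assoc[symmetric] inner_commute)

lemma b0_in_V: "b0 \<in> V"
  unfolding b0vec_def by (rule projP_in_V)

lemma b0_inner_V: "w \<in> V \<Longrightarrow> b0 \<bullet> w = (A *v n0) \<bullet> w"
  by (simp add: b0vec_def inner_commute[of _ w] inner_projP_V)

lemma hq_n0_add: "w \<in> V \<Longrightarrow> hq A (n0 + w) = hq A n0 + trs_obj PAP b0 w"
  using b0_inner_V[of w] PAP_quadratic[of w] symmetric_matrix_inner[OF symmetric_A, of n0 w]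
  by (simp add: hq_def trs_obj_def matrix_vector_right_distrib inner_add_left inner_add_right inner_commute)

lemma gam_pos: "0 < \<gamma>" and gam_squared: "\<gamma>\<^sup>2 = 1 - (norm n0)\<^sup>2"
proof -
  have "(norm n0)\<^sup>2 < 1"
    using norm_n0_less_1 by (simp add: power_less_one_iff abs_square_less_1)
  then show "0 < \<gamma>" "\<gamma>\<^sup>2 = 1 - (norm n0)\<^sup>2"
    by (simp_all add: gam_def)
qed

lemma crq_feasible_iff: "crq_feasible C b v \<longleftrightarrow> v - n0 \<in> V \<and> norm (v - n0) = \<gamma>"
proof -
  have "transpose C *v v = b \<longleftrightarrow> v - n0 \<in> V"
    using transpose_C_n0 by (auto simp: matrix_vector_mult_diff_distrib)
  moreover have "v \<bullet> v = 1 \<longleftrightarrow> norm (v - n0) = \<gamma>" if "v - n0 \<in> V"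
  proof -
    have "v \<bullet> v = n0 \<bullet> n0 + (v - n0) \<bullet> (v - n0)"
      using n0_orthogonal_V[OF that] by (simp add: inner_diff_left inner_diff_right inner_commute)
    then have "v \<bullet> v = (norm n0)\<^sup>2 + (norm (v - n0))\<^sup>2"
      by (simp add: power2_norm_eq_inner)
    then show ?thesis
      using gam_squared gam_pos by (smt (verit) norm_ge_zero power2_eq_iff_nonneg)
  qed
  ultimately show ?thesis
    unfolding crq_feasible_def by blast
qed

lemma lg_feasible_iff: "lg_feasible A C b l u \<longleftrightarrow> trs_kkt PAP b0 V \<gamma> l u"
proof -
  have "(\<forall>w\<in>V. w \<bullet> (PAP *v u - l *\<^sub>R u + b0) = 0) \<longleftrightarrow> PAP *v u - l *\<^sub>R u + b0 = 0" if u: "u \<in> V"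
  proof
    assume orth: "\<forall>w\<in>V. w \<bullet> (PAP *v u - l *\<^sub>R u + b0) = 0"
    have "PAP *v u - l *\<^sub>R u + b0 \<in> V"
      using u PAP_in_V b0_in_V subspace_V by (intro subspace_add subspace_diff subspace_scale) auto
    with orth show "PAP *v u - l *\<^sub>R u + b0 = 0"
      by (metis inner_eq_zero_iff)
  qed simp
  moreover have "(PAP - l *\<^sub>R mat 1) *v u = - b0 \<longleftrightarrow> PAP *v u - l *\<^sub>R u + b0 = 0"
    by (simp add: shifted_matrix_vector_mult eq_neg_iff_add_eq_0)
  ultimately show ?thesis
    unfolding lg_feasible_def trs_kkt_def by auto
qed

lemma lg_minimizer_psd:
  assumes "b0 \<noteq> 0" "lg_minimizer A C b l u"
  shows "psd_on PAP l V"
proof -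
  have "trs_kkt PAP b0 V \<gamma> l u" and "\<And>l' u'. trs_kkt PAP b0 V \<gamma> l' u' \<Longrightarrow> l \<le> l'"
    using assms(2) by (auto simp: lg_minimizer_def lg_feasible_iff)
  then show ?thesis
    by (rule trs_least_multiplier_psd[OF PAP_symmetric subspace_V b0_in_V \<open>b0 \<noteq> 0\<close> gam_pos])
qed

lemma lg_minimizer_crq_minimizer:
  assumes "b0 \<noteq> 0" "lg_minimizer A C b l u"
  shows "crq_minimizer A C b (n0 + u)"
proof -
  have kkt: "trs_kkt PAP b0 V \<gamma> l u"
    using assms(2) by (simp add: lg_minimizer_def lg_feasible_iff)
  then have min: "trs_minimizer PAP b0 V \<gamma> u"
    using trs_kkt_psd_imp_minimizer[OF PAP_symmetric subspace_V _ lg_minimizer_psd[OF assms]] by blast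
  show ?thesis
    unfolding crq_minimizer_def
  proof (intro conjI allI impI)
    show "crq_feasible C b (n0 + u)"
      using min by (simp add: crq_feasible_iff trs_minimizer_def)
    fix w assume "crq_feasible C b w"
    then have "trs_obj PAP b0 u \<le> trs_obj PAP b0 (w - n0)"
      using min by (simp add: crq_feasible_iff trs_minimizer_def)
    then show "hq A (n0 + u) \<le> hq A w"
      using hq_n0_add[of u] hq_n0_add[of "w - n0"] min \<open>crq_feasible C b w\<close>
      by (simp add: trs_minimizer_def crq_feasible_iff)
  qed
qed

text \<open>A QEPmin pair \<open>(l', z)\<close> either makes \<open>z\<close> an eigenvector of \<open>PAP\<close> in \<open>V\<close> (if \<open>b\<^sub>0 \<bullet> z = 0\<close>)
  or yields the LGopt solution \<open>-(\<gamma>\<^sup>2 / b\<^sub>0 \<bullet> z) (PAP - l' I) z\<close>; either way \<open>l'\<close> is not below the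
  LGopt multiplier.\<close>

lemma qep_feasible_multiplier_ge:
  assumes "b0 \<noteq> 0" and lg: "lg_minimizer A C b l u" and qep: "qep_feasible A C b l' z"
  shows "l \<le> l'"
proof -
  define y where "y = PAP *v z - l' *\<^sub>R z"
  have z: "z \<noteq> 0" "z \<in> V"
    and eqn: "PAP *v y - l' *\<^sub>R y = (1 / \<gamma>\<^sup>2) *\<^sub>R ((b0 \<bullet> z) *\<^sub>R b0)"
    using qep by (auto simp: qep_feasible_def y_def Let_def shifted_matrix_vector_mult
        simp flip: matrix_vector_mul_assoc)
  have "y \<bullet> y = z \<bullet> (PAP *v y - l' *\<^sub>R y)"
    using symmetric_matrix_inner[OF PAP_symmetric, of z y]
    by (simp add: y_def inner_diff_left inner_diff_right inner_commute right_diff_distrib)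
  also have "\<dots> = (b0 \<bullet> z)\<^sup>2 / \<gamma>\<^sup>2"
    by (simp add: eqn inner_commute power2_eq_square)
  finally have yy: "y \<bullet> y = (b0 \<bullet> z)\<^sup>2 / \<gamma>\<^sup>2" .
  show ?thesis
  proof (cases "b0 \<bullet> z = 0")
    case True
    then have "PAP *v z = l' *\<^sub>R z"
      using yy by (simp add: y_def)
    then have "shifted_form PAP l z = (l' - l) * (z \<bullet> z)"
      by (simp add: shifted_form_def algebra_simps)
    moreover have "0 \<le> shifted_form PAP l z"
      using lg_minimizer_psd[OF assms(1) lg] z by (simp add: psd_on_def)
    moreover have "0 < z \<bullet> z"
      using z by simp
    ultimately show ?thesis
      using zero_le_mult_iff[of "l' - l" "z \<bullet> z"] by linarith
  next
    case False
    define u' where "u' = - (\<gamma>\<^sup>2 / (b0 \<bullet> z)) *\<^sub>R y"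
    have "y \<in> V"
      unfolding y_def using z(2) by (intro subspace_diff[OF subspace_V] subspace_scale[OF subspace_V] PAP_in_V)
    then have "u' \<in> V"
      unfolding u'_def by (rule subspace_scale[OF subspace_V])
    moreover have "PAP *v u' - l' *\<^sub>R u' = - (\<gamma>\<^sup>2 / (b0 \<bullet> z)) *\<^sub>R (PAP *v y - l' *\<^sub>R y)"
      by (simp add: u'_def matrix_vector_mult_scaleR matrix_vector_mult_minus algebra_simps)
    then have "PAP *v u' - l' *\<^sub>R u' + b0 = 0"
      using False gam_pos by (simp add: eqn)
    moreover have "norm u' = \<gamma>"
      using False gam_pos yy
      by (simp add: u'_def norm_eq_sqrt_inner power2_eq_square field_simps real_sqrt_mult)
    ultimately have "lg_feasible A C b l' u'"
      by (simp add: lg_feasible_iff trs_kkt_def)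
    with lg show ?thesis
      unfolding lg_minimizer_def by blast
  qed
qed

lemma easy_case_shifted_form_definite:
  assumes easy: "qep_easy_case A C b" and "b0 \<noteq> 0" and lg: "lg_minimizer A C b l u"
    and "z \<in> V" "shifted_form PAP l z = 0"
  shows "z = 0"
proof (rule ccontr)
  assume "z \<noteq> 0"
  have psd: "psd_on PAP l V"
    by (rule lg_minimizer_psd[OF \<open>b0 \<noteq> 0\<close> lg])
  have "PAP *v z - l *\<^sub>R z \<in> V"
    using \<open>z \<in> V\<close> by (intro subspace_diff[OF subspace_V] subspace_scale[OF subspace_V] PAP_in_V)
  then have eig: "PAP *v z = l *\<^sub>R z"
    using psd_on_shifted_form_zero_imp_orthogonal[OF PAP_symmetric subspace_V psd assms(4,5)]
    by (metis eq_iff_diff_eq_0 inner_eq_zero_iff)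
  have "z \<bullet> (PAP *v u - l *\<^sub>R u + b0) = 0"
    using lg \<open>z \<in> V\<close> by (auto simp: lg_minimizer_def lg_feasible_iff trs_kkt_def)
  moreover have "z \<bullet> (PAP *v u) = l * (z \<bullet> u)"
    using symmetric_matrix_inner[OF PAP_symmetric, of z u] eig by (simp add: inner_commute)
  ultimately have b0z: "b0 \<bullet> z = 0"
    by (simp add: inner_add_right inner_diff_right inner_commute)
  have "qep_feasible A C b l z"
    using \<open>z \<noteq> 0\<close> \<open>z \<in> V\<close> eig b0z
    by (simp add: qep_feasible_def Let_def shifted_matrix_vector_mult flip: matrix_vector_mul_assoc)
  then have "qep_minimizer A C b l z"
    using qep_feasible_multiplier_ge[OF \<open>b0 \<noteq> 0\<close> lg] by (simp add: qep_minimizer_def)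
  with b0z easy show False
    by (auto simp: qep_easy_case_def qep_hard_case_def)
qed

lemma lanczos_basis:
  assumes "b0 \<noteq> 0" "1 \<le> k" "k \<le> kmax PAP b0"
  shows "\<And>i j. i \<in> {1..k} \<Longrightarrow> j \<in> {1..k} \<Longrightarrow> lq PAP b0 i \<bullet> lq PAP b0 j = (if i = j then 1 else 0)"
    and "b0 = norm b0 *\<^sub>R lq PAP b0 1"
    and "span (lq PAP b0 ` {1..k}) \<subseteq> V"
    and "krylov PAP b0 k \<subseteq> span (lq PAP b0 ` {1..k})"
proof -
  have no_breakdown: "lbeta PAP b0 (Suc j) \<noteq> 0" if "1 \<le> j" "j < kmax PAP b0" for j
    using not_less_Least[OF that(2)[unfolded kmax_def]] that(1) by simp
  have lq: "lq PAP b0 ` {1..k} = lanczos_q PAP b0 ` {1..k}"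
    by (auto simp: lq_eq_lanczos_q)
  show "lq PAP b0 i \<bullet> lq PAP b0 j = (if i = j then 1 else 0)" if "i \<in> {1..k}" "j \<in> {1..k}" for i j
    using lanczos_orthonormal[OF PAP_symmetric \<open>b0 \<noteq> 0\<close> no_breakdown assms(3), of i j] that
    by (simp add: lq_eq_lanczos_q)
  show "b0 = norm b0 *\<^sub>R lq PAP b0 1"
    using \<open>b0 \<noteq> 0\<close> by (simp add: lq_eq_lanczos_q lanczos_q_1)
  have "lanczos_q PAP b0 j \<in> V" for j
    using lanczos_q_in_invariant_subspace[OF subspace_V b0_in_V PAP_in_V] .
  then show "span (lq PAP b0 ` {1..k}) \<subseteq> V"
    unfolding lq by (intro span_minimal subspace_V) auto
  show "krylov PAP b0 k \<subseteq> span (lq PAP b0 ` {1..k})"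
    unfolding lq by (rule krylov_subset_span_lanczos)
qed

end


section \<open>Error bounds for the Krylov approximation\<close>

lemma subspace_sphere_point_near:
  fixes q y :: "'a::real_normed_vector"
  assumes "subspace U" "q \<in> U" "norm q = 1" "y \<in> U" "0 \<le> r"
  shows "\<exists>w\<in>U. norm w = r \<and> norm (w - y) = \<bar>r - norm y\<bar>"
proof (cases "y = 0")
  case True
  then show ?thesis
    using assms by (intro bexI[of _ "r *\<^sub>R q"]) (auto simp: subspace_scale)
next
  case False
  have "(r / norm y) *\<^sub>R y - y = (r / norm y - 1) *\<^sub>R y"
    by (simp add: algebra_simps)
  moreover have "(r / norm y - 1) * norm y = r - norm y"
    using False by (simp add: field_simps)
  ultimately have "norm ((r / norm y) *\<^sub>R y - y) = \<bar>r - norm y\<bar>"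
    by (metis abs_mult abs_norm_cancel norm_scaleR)
  then show ?thesis
    using assms False by (intro bexI[of _ "(r / norm y) *\<^sub>R y"]) (auto simp: subspace_scale)
qed

lemma norm_diff_le_twice:
  fixes u w y :: "'a::real_normed_vector"
  assumes "norm (w - y) \<le> \<bar>norm u - norm y\<bar>"
  shows "norm (w - u) \<le> 2 * norm (y - u)"
proof -
  have "norm (w - u) \<le> norm (w - y) + norm (y - u)"
    using norm_triangle_ineq[of "w - y" "y - u"] by simp
  moreover have "\<bar>norm u - norm y\<bar> \<le> norm (y - u)"
    by (metis norm_minus_commute norm_triangle_ineq3)
  ultimately show ?thesis
    using assms by linarith
qed

lemma sqrt_ratio_bound:
  fixes a c x y :: real
  assumes "0 < a" "a * x\<^sup>2 \<le> c * y\<^sup>2"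
  shows "\<bar>x\<bar> \<le> sqrt (c / a) * \<bar>y\<bar>"
proof -
  have "x\<^sup>2 \<le> (c / a) * y\<^sup>2"
    using assms by (simp add: pos_le_divide_eq mult.commute mult.left_commute)
  then have "sqrt (x\<^sup>2) \<le> sqrt ((c / a) * y\<^sup>2)"
    by (rule real_sqrt_le_mono)
  then show ?thesis
    by (metis real_sqrt_abs real_sqrt_mult)
qed

lemma quadratic_form_comparison:
  fixes Q :: "'a::real_normed_vector \<Rightarrow> real"
  assumes lower: "\<And>z. z \<in> V \<Longrightarrow> lo * (norm z)\<^sup>2 \<le> Q z"
    and upper: "\<And>z. z \<in> V \<Longrightarrow> Q z \<le> hi * (norm z)\<^sup>2"
    and bound: "\<And>z. z \<in> V \<Longrightarrow> Q z \<le> c * (norm z)\<^sup>2"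
    and "0 < lo" "lo \<le> hi" "0 \<le> c"
    and "d \<in> V" "e \<in> V" "Q d \<le> Q e" "norm e \<le> \<rho>"
  shows "Q d \<le> c * \<rho>\<^sup>2" and "norm d \<le> sqrt (hi / lo) * \<rho>"
proof -
  have "0 \<le> \<rho>"
    using norm_ge_zero[of e] \<open>norm e \<le> \<rho>\<close> by linarith
  then have e: "(norm e)\<^sup>2 \<le> \<rho>\<^sup>2"
    using \<open>norm e \<le> \<rho>\<close> by (intro power_mono) auto
  have "Q d \<le> c * (norm e)\<^sup>2"
    using bound[OF \<open>e \<in> V\<close>] \<open>Q d \<le> Q e\<close> by linarith
  also have "\<dots> \<le> c * \<rho>\<^sup>2"
    using e \<open>0 \<le> c\<close> by (rule mult_left_mono)
  finally show "Q d \<le> c * \<rho>\<^sup>2" .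
  have "lo * (norm d)\<^sup>2 \<le> hi * (norm e)\<^sup>2"
    using lower[OF \<open>d \<in> V\<close>] upper[OF \<open>e \<in> V\<close>] \<open>Q d \<le> Q e\<close> by linarith
  also have "\<dots> \<le> hi * \<rho>\<^sup>2"
    using e \<open>0 < lo\<close> \<open>lo \<le> hi\<close> by (intro mult_left_mono) auto
  finally have "\<bar>norm d\<bar> \<le> sqrt (hi / lo) * \<bar>\<rho>\<bar>"
    using \<open>0 < lo\<close> by (intro sqrt_ratio_bound)
  with \<open>0 \<le> \<rho>\<close> show "norm d \<le> sqrt (hi / lo) * \<rho>"
    by simp
qed

context crq_problem
begin

lemma shifted_form_null_basis:
  fixes S1 :: "real^'k^'n"
  assumes S1_orth: "transpose S1 ** S1 = mat 1" and S1_span: "range ((*v) S1) = V"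
  shows "shifted_form PAP l (S1 *v z) = shifted_form (transpose S1 ** A ** S1) l z"
proof -
  have "(S1 *v z) \<bullet> (PAP *v (S1 *v z)) = (S1 *v z) \<bullet> (A *v (S1 *v z))"
    using S1_span by (intro PAP_quadratic) auto
  also have "\<dots> = z \<bullet> ((transpose S1 ** A ** S1) *v z)"
    using inner_transpose_matrix[of z S1 "A *v (S1 *v z)"]
    by (simp add: matrix_vector_mul_assoc matrix_mul_assoc inner_commute)
  finally show ?thesis
    using orthonormal_columns_norm[OF S1_orth, of z] by (simp add: shifted_form_def dot_square_norm)
qed

lemma shifted_form_spectral_bounds:
  fixes S1 :: "real^'k^'n"
  assumes S1_orth: "transpose S1 ** S1 = mat 1" and S1_span: "range ((*v) S1) = V" and "d \<in> V"
  defines "H \<equiv> transpose S1 ** A ** S1"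
  shows "(Min (eigvals H) - l) * (norm d)\<^sup>2 \<le> shifted_form PAP l d"
    and "shifted_form PAP l d \<le> (Max (eigvals H) - l) * (norm d)\<^sup>2"
    and "shifted_form PAP l d \<le> onorm ((*v) (H - l *\<^sub>R mat 1)) * (norm d)\<^sup>2"
    and "Min (eigvals H) \<le> Max (eigvals H)"
proof -
  obtain z where d: "d = S1 *v z"
    using S1_span \<open>d \<in> V\<close> by blast
  have Q: "shifted_form PAP l d = z \<bullet> (H *v z) - l * (z \<bullet> z)" and nd: "norm d = norm z"
    using shifted_form_null_basis[OF S1_orth S1_span] orthonormal_columns_norm[OF S1_orth]
    by (simp_all add: d H_def shifted_form_def)
  have "transpose H = H"
    by (simp add: H_def matrix_transpose_mul symmetric_A matrix_mul_assoc)
  note rayleigh = symmetric_rayleigh_bounds[OF this]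
  show "Min (eigvals H) \<le> Max (eigvals H)"
    by (rule rayleigh(4))
  show "(Min (eigvals H) - l) * (norm d)\<^sup>2 \<le> shifted_form PAP l d"
    using rayleigh(2)[of z] by (simp add: Q nd power2_norm_eq_inner left_diff_distrib)
  show "shifted_form PAP l d \<le> (Max (eigvals H) - l) * (norm d)\<^sup>2"
    using rayleigh(3)[of z] by (simp add: Q nd power2_norm_eq_inner left_diff_distrib)
  have "shifted_form PAP l d = z \<bullet> ((H - l *\<^sub>R mat 1) *v z)"
    by (simp add: Q shifted_matrix_vector_mult inner_diff_right)
  also have "\<dots> \<le> norm z * norm ((H - l *\<^sub>R mat 1) *v z)"
    by (rule norm_cauchy_schwarz)
  also have "\<dots> \<le> norm z * (onorm ((*v) (H - l *\<^sub>R mat 1)) * norm z)"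
    by (intro mult_left_mono onorm) auto
  finally show "shifted_form PAP l d \<le> onorm ((*v) (H - l *\<^sub>R mat 1)) * (norm d)\<^sup>2"
    by (simp add: nd power2_eq_square mult.commute mult.left_commute)
qed

text \<open>An eigenvector of \<open>H\<close> for \<open>\<lambda>\<^sub>*\<close> would give a minimiser \<open>z\<close> of QEPmin with
  \<open>b\<^sub>0 \<bullet> z = 0\<close>, which the easy case excludes.\<close>

lemma lg_multiplier_below_spectrum:
  fixes S1 :: "real^'k^'n"
  assumes S1_orth: "transpose S1 ** S1 = mat 1" and S1_span: "range ((*v) S1) = V"
    and easy: "qep_easy_case A C b" and "b0 \<noteq> 0" and lg: "lg_minimizer A C b l u"
  shows "l < Min (eigvals (transpose S1 ** A ** S1))"
proof -
  let ?H = "transpose S1 ** A ** S1"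
  have "transpose ?H = ?H"
    by (simp add: matrix_transpose_mul symmetric_A matrix_mul_assoc)
  then obtain y where y: "y \<noteq> 0" "?H *v y = Min (eigvals ?H) *\<^sub>R y"
    using symmetric_rayleigh_bounds(1) unfolding eigvals_def by blast
  have z: "S1 *v y \<in> V" "S1 *v y \<noteq> 0"
    using S1_span orthonormal_columns_norm[OF S1_orth, of y] y(1) by auto
  have Q: "shifted_form PAP l (S1 *v y) = (Min (eigvals ?H) - l) * (y \<bullet> y)"
    unfolding shifted_form_null_basis[OF S1_orth S1_span] using y(2)
    by (simp add: shifted_form_def left_diff_distrib)
  have "0 \<le> shifted_form PAP l (S1 *v y)"
    using lg_minimizer_psd[OF \<open>b0 \<noteq> 0\<close> lg] z(1) by (simp add: psd_on_def)
  moreover have "shifted_form PAP l (S1 *v y) \<noteq> 0"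
    using easy_case_shifted_form_definite[OF easy \<open>b0 \<noteq> 0\<close> lg z(1)] z(2) by blast
  ultimately have "0 < (Min (eigvals ?H) - l) * (y \<bullet> y)"
    unfolding Q by linarith
  then show ?thesis
    using mult_nonpos_nonneg[of "Min (eigvals ?H) - l" "y \<bullet> y"] by force
qed

lemma krylov_trs_comparison:
  assumes "b0 \<noteq> 0" and lg: "lg_minimizer A C b lams us"
    and k: "1 \<le> k" "k \<le> kmax PAP b0"
    and rlg: "rlg_minimizer PAP b0 \<gamma> k mu x"
    and v: "v \<in> (\<lambda>y. n0 + y) ` krylov PAP b0 k"
  defines "uk \<equiv> \<Sum>j=1..k. x j *\<^sub>R lq PAP b0 j"
  obtains w where "uk - us \<in> V" "w - us \<in> V"
    and "hq A (n0 + uk) - hq A (n0 + us) = shifted_form PAP lams (uk - us)"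
    and "shifted_form PAP lams (uk - us) \<le> shifted_form PAP lams (w - us)"
    and "(mu - lams) * \<gamma>\<^sup>2 = shifted_form PAP lams (uk - us) - b0 \<bullet> (uk - us)"
    and "norm (w - us) \<le> 2 * norm (v - (n0 + us))"
proof -
  let ?U = "span (lq PAP b0 ` {1..k})"
  note basis = lanczos_basis[OF \<open>b0 \<noteq> 0\<close> k]
  have kkt_V: "trs_kkt PAP b0 V \<gamma> lams us"
    using lg by (simp add: lg_minimizer_def lg_feasible_iff)
  have kkt_U: "trs_kkt PAP b0 ?U \<gamma> mu uk" and psd_U: "psd_on PAP mu ?U"
    using rlg_minimizer_imp_trs_kkt_psd[OF PAP_symmetric gam_pos basis(1,2) k(1) rlg]
    by (simp_all add: uk_def)
  obtain y where y: "y \<in> ?U" "v = n0 + y"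
    using v basis(4) by blast
  have q1: "lq PAP b0 1 \<in> ?U" "norm (lq PAP b0 1) = 1"
    using k(1) basis(1)[of 1 1] by (auto simp: norm_eq_sqrt_inner intro!: span_base imageI)
  obtain w where w: "w \<in> ?U" "norm w = \<gamma>" "norm (w - y) = \<bar>\<gamma> - norm y\<bar>"
    using subspace_sphere_point_near[OF subspace_span q1 y(1) less_imp_le[OF gam_pos]] by blast
  note gap = trs_subspace_restriction[OF PAP_symmetric subspace_span basis(3) kkt_V kkt_U psd_U w(1,2)]
  have us: "us \<in> V" "norm us = \<gamma>" and uk: "uk \<in> V"
    using kkt_V kkt_U basis(3) by (auto simp: trs_kkt_def)
  have "uk - us \<in> V"
    by (rule subspace_diff[OF subspace_V uk us(1)])
  moreover have "w - us \<in> V"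
    using w(1) basis(3) by (intro subspace_diff[OF subspace_V _ us(1)]) blast
  moreover have "hq A (n0 + uk) - hq A (n0 + us) = shifted_form PAP lams (uk - us)"
    using gap(1) hq_n0_add[OF us(1)] hq_n0_add[OF uk] by simp
  moreover have "norm (w - us) \<le> 2 * norm (v - (n0 + us))"
    using norm_diff_le_twice[of w y us] w(3) us(2) y(2) by simp
  ultimately show ?thesis
    by (rule that[OF _ _ _ gap(2,3)])
qed

lemma krylov_error_bounds:
  fixes S1 :: "real^'k^'n"
  assumes S1_orth: "transpose S1 ** S1 = mat 1" and S1_span: "range ((*v) S1) = V"
    and easy: "qep_easy_case A C b" and "b0 \<noteq> 0" and lg: "lg_minimizer A C b lams us"
    and k: "1 \<le> k" "k \<le> kmax PAP b0"
    and rlg: "rlg_minimizer PAP b0 \<gamma> k mu x"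
    and v: "v \<in> (\<lambda>y. n0 + y) ` krylov PAP b0 k"
  defines "vk \<equiv> n0 + (\<Sum>j=1..k. x j *\<^sub>R lq PAP b0 j)"
    and "\<theta>min \<equiv> Min (eigvals (transpose S1 ** A ** S1))"
    and "\<theta>max \<equiv> Max (eigvals (transpose S1 ** A ** S1))"
    and "nH \<equiv> onorm ((*v) (transpose S1 ** A ** S1 - lams *\<^sub>R mat 1))"
    and "N \<equiv> norm (v - (n0 + us))"
  shows "0 \<le> hq A vk - hq A (n0 + us)"
    and "hq A vk - hq A (n0 + us) \<le> 4 * nH * N\<^sup>2"
    and "norm (vk - (n0 + us)) \<le> 2 * sqrt ((\<theta>max - lams) / (\<theta>min - lams)) * N"
    and "\<bar>mu - lams\<bar>
      \<le> (1 / \<gamma>\<^sup>2) * (4 * nH * N\<^sup>2 + 2 * sqrt ((\<theta>max - lams) / (\<theta>min - lams)) * norm b0 * N)"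
proof -
  define uk where "uk = (\<Sum>j=1..k. x j *\<^sub>R lq PAP b0 j)"
  define E where "E = shifted_form PAP lams (uk - us)"
  have vk: "vk = n0 + uk"
    by (simp add: vk_def uk_def)
  obtain w where d: "uk - us \<in> V" "w - us \<in> V"
    and gap: "hq A (n0 + uk) - hq A (n0 + us) = E"
    and E_le: "E \<le> shifted_form PAP lams (w - us)"
    and mu: "(mu - lams) * \<gamma>\<^sup>2 = E - b0 \<bullet> (uk - us)"
    and w: "norm (w - us) \<le> 2 * N"
    by (rule krylov_trs_comparison[OF \<open>b0 \<noteq> 0\<close> lg k rlg v, folded uk_def N_def E_def])
  have lower: "(\<theta>min - lams) * (norm z)\<^sup>2 \<le> shifted_form PAP lams z"
    and upper: "shifted_form PAP lams z \<le> (\<theta>max - lams) * (norm z)\<^sup>2"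
    and op_norm: "shifted_form PAP lams z \<le> nH * (norm z)\<^sup>2" if "z \<in> V" for z
    using shifted_form_spectral_bounds[OF S1_orth S1_span that] by (simp_all add: \<theta>min_def \<theta>max_def nH_def)
  have "lams < \<theta>min"
    unfolding \<theta>min_def by (rule lg_multiplier_below_spectrum[OF S1_orth S1_span easy \<open>b0 \<noteq> 0\<close> lg])
  moreover have "\<theta>min \<le> \<theta>max"
    using shifted_form_spectral_bounds(4)[OF S1_orth S1_span d(1)] by (simp add: \<theta>min_def \<theta>max_def)
  moreover have "0 \<le> nH"
    unfolding nH_def by (rule onorm_pos_le) simp
  ultimately have E_bound: "E \<le> nH * (2 * N)\<^sup>2"
    and uk_close: "norm (uk - us) \<le> sqrt ((\<theta>max - lams) / (\<theta>min - lams)) * (2 * N)"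
    using quadratic_form_comparison[OF lower upper op_norm _ _ _ d E_le[unfolded E_def] w]
    by (simp_all add: E_def)
  have E_nonneg: "0 \<le> E"
    using lg_minimizer_psd[OF \<open>b0 \<noteq> 0\<close> lg] d(1) by (simp add: E_def psd_on_def)
  then show "0 \<le> hq A vk - hq A (n0 + us)"
    by (simp add: vk gap)
  show "hq A vk - hq A (n0 + us) \<le> 4 * nH * N\<^sup>2"
    using E_bound by (simp add: vk gap power_mult_distrib)
  show "norm (vk - (n0 + us)) \<le> 2 * sqrt ((\<theta>max - lams) / (\<theta>min - lams)) * N"
    using uk_close by (simp add: vk mult_ac)
  have "\<bar>mu - lams\<bar> * \<gamma>\<^sup>2 = \<bar>E - b0 \<bullet> (uk - us)\<bar>"
    by (simp flip: mu add: abs_mult)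
  also have "\<dots> \<le> E + norm b0 * norm (uk - us)"
    using E_nonneg Cauchy_Schwarz_ineq2[of b0 "uk - us"] by linarith
  also have "\<dots> \<le> 4 * nH * N\<^sup>2 + 2 * sqrt ((\<theta>max - lams) / (\<theta>min - lams)) * norm b0 * N"
    using E_bound mult_left_mono[OF uk_close norm_ge_zero[of b0]] by (simp add: power_mult_distrib mult_ac)
  finally show "\<bar>mu - lams\<bar>
      \<le> (1 / \<gamma>\<^sup>2) * (4 * nH * N\<^sup>2 + 2 * sqrt ((\<theta>max - lams) / (\<theta>min - lams)) * norm b0 * N)"
    using gam_pos by (simp add: field_simps)
qed

end

theorem lemma4p1:
  fixes A :: "real^'n^'n" and C :: "real^'m^'n" and b :: "real^'m"
    and S1 :: "real^'k^'n"
    and vs :: "real^'n" and lams :: real and us :: "real^'n"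
    and k :: nat and mu :: real and x :: "nat \<Rightarrow> real" and v :: "real^'n"
  assumes symA: "transpose A = A"
    and mn: "CARD('m) < CARD('n)"
    and rankC: "rank C = CARD('m)"
    and n0: "norm (n0vec C b) < 1"
    and b0: "b0vec A C b \<noteq> 0"
    and S1_orth: "transpose S1 ** S1 = mat 1"
    and S1_span: "range ((*v) S1) = {y. transpose C *v y = 0}"
    and easy: "qep_easy_case A C b"
    and vs_min: "crq_minimizer A C b vs"
    and vs_unique: "\<forall>w. crq_minimizer A C b w \<longrightarrow> w = vs"
    and lg_min: "lg_minimizer A C b lams us"
    and k: "1 \<le> k" "k \<le> kmax (projP C ** A ** projP C) (b0vec A C b)"
    and rlg: "rlg_minimizer (projP C ** A ** projP C) (b0vec A C b) (gam C b) k mu x"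
    and v_kry: "v \<in> (\<lambda>y. n0vec C b + y) ` krylov (projP C ** A ** projP C) (b0vec A C b) k"
    and v_nz: "v \<noteq> 0"
  shows
    "let M = projP C ** A ** projP C; b0 = b0vec A C b; g = gam C b;
         vk = n0vec C b + (\<Sum>j=1..k. x j *\<^sub>R lq M b0 j);
         H = transpose S1 ** A ** S1;
         thmin = Min (eigvals H); thmax = Max (eigvals H);
         kappa = (thmax - lams) / (thmin - lams);
         nH = onorm ((*v) (H - lams *\<^sub>R mat 1))
     in 0 \<le> hq A vk - hq A vs
        \<and> hq A vk - hq A vs \<le> 4 * nH * (norm (v - vs))\<^sup>2
        \<and> norm (vk - vs) \<le> 2 * sqrt kappa * norm (v - vs)
        \<and> \<bar>mu - lams\<bar> \<le> (1 / g\<^sup>2) * (4 * nH * (norm (v - vs))\<^sup>2 + 2 * sqrt kappa * norm b0 * norm (v - vs))"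
proof -
  interpret crq_problem A C b
    using symA rankC n0 by unfold_locales
  have "vs = n0vec C b + us"
    using vs_unique lg_minimizer_crq_minimizer[OF b0 lg_min] by blast
  then show ?thesis
    using krylov_error_bounds[OF S1_orth S1_span easy b0 lg_min k rlg v_kry]
    unfolding Let_def by simp
qed

end
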